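(* Let $0<\varepsilon<\frac{1}{1-\gamma}$ and $0<\delta<1$ be real numbers. Let $M=\langle\hat S,\hat A,T,R,\gamma\rangle$ be any Case II meta-MDP with inner $n$-agent stochastic game $G=\langle S,A,T_{\text{inner}},R_{\text{inner}}\rangle$, and let $M_d=\langle\hat S_d,\hat A_d,T_d,R_d,\gamma\rangle$ be its discretised version with grid size $\lambda>0$ (all as defined in the context). There exist inputs $m=m\left(\frac1\varepsilon,\frac1\delta\right)$ and $\varepsilon_1$ satisfying $$m\left(\tfrac{1}{\varepsilon},\tfrac{1}{\delta}\right)=\tilde O\left(\frac{(|S||A|)^{nh}}{\varepsilon^2(1-\gamma)^4}\right)\quad\text{and}\quad \frac1{\varepsilon_1}=O\left(\frac1\varepsilon\right),$$ such that if the R-MAX algorithm is executed on $M_d$ with inputs $m$ and $\varepsilon_1$, the following holds. Let $\mathcal A_t$ denote R-MAX's policy at time $t$ and $\hat s_t$ the state at time $t$. With probability at least $1-\delta$, the inequality $$V_{M_d}^*(\hat s_t)-V_{M_d}^{\mathcal A_t}(\hat s_t)\le\varepsilon$$ is true for all but $$\tilde O\left(\frac{(|S||A|)^{2nh}\left(\frac{2\sqrt{|S||A|}}{\lambda}+1\right)^{|S||A|}}{\varepsilon^3(1-\gamma)^6}\right)$$ timesteps $t$.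
   Context: Inner game. $G$ is a discrete stochastic game with $n$ agents, finite state set $S$, finite action set $A$ for each agent, finite horizon $h_{\text{inner}}$, inner discount factor $1$, and inner rewards satisfying $0\le R_{\text{inner}}(s,a)\le 1/h_{\text{inner}}$. Each inner agent's policy is a Q-table $\phi\in\mathbb R^{|S|\times|A|}$; because inner returns lie in $[0,1]$, the entries of these tables lie in $[0,1]$. Meta-game (Case II). $M=\langle\hat S,\hat A,T,R,\gamma\rangle$ is an MDP with discount $\gamma\in[0,1)$. A meta-state is the collection of all $n$ agents' past inner-game trajectories $(s_0,a_0,s_1,a_1,\dots)$; with $h_{\text{meta}}$ the meta-game horizon and $h=h_{\text{inner}}\cdot h_{\text{meta}}$ the maximum combined trajectory length, $\hat S$ is a finite set of cardinality $(|S||A|)^{nh}$. A meta-action is the current Q-table of the one controlled agent, so $\hat A=[0,1]^{|S||A|}$, contained in the Euclidean ball of radius $\sqrt{|S||A|}$. Meta-rewards satisfy $0\le R\le R_{\max}=1$, and $V_{\max}=1/(1-\gamma)$. Discretisation. The meta-state space is already finite, so $\hat S_d=\hat S$. $\hat A_d\subset\hat A$ is a finite net of cubic grid points of side $\lambda$, with $|\hat A_d|\le\left(\frac{2\sqrt{|S||A|}}{\lambda}+1\right)^{|S||A|}$. $T_d$ and $R_d$ are $T$ and $R$ restricted to actions in $\hat A_d$. So $M_d$ is a tabular MDP. Values. $V^\pi_{M_d}$ is the expected $\gamma$-discounted cumulative reward of policy $\pi$ in $M_d$, and $V^*_{M_d}$ is the optimal value. R-MAX with inputs $m,\varepsilon_1$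 on a tabular MDP. It keeps counts $n(s,a)$, $n(s,a,s')$ and reward sums for the first $m$ visits of each pair $(s,a)$. A pair is $m$-known once visited $m$ times. In the empirical $m$-known model, $m$-known pairs use the empirical mean reward and the empirical transition frequencies $n(s,a,s')/n(s,a)$, and all other pairs are self-loops with reward $R_{\max}$ (so their value is $V_{\max}$). Whenever a pair becomes $m$-known, the action-value table is recomputed by $\left\lceil\frac{\ln(1/(\varepsilon_1(1-\gamma)))}{1-\gamma}\right\rceil$ sweeps of value iteration in this model. At every timestep the algorithm plays greedily with respect to its current action-value table; this is its policy at that time. $\tilde O$ hides logarithmic factors. *)

theory Defs
  imports "HOL-Probability.Probability"
begin

section \<open>Markov decision processes, policies and values\<close>

record ('s, 'a) mdp =
  states  :: "'s set"
  actions :: "'a set"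
  trans   :: "'s \<Rightarrow> 'a \<Rightarrow> 's pmf"
  rew     :: "'s \<Rightarrow> 'a \<Rightarrow> real"
  disc    :: real

definition mdp :: "('s, 'a) mdp \<Rightarrow> bool" where
  "mdp M \<longleftrightarrow>
     states M \<noteq> {} \<and> actions M \<noteq> {} \<and>
     (\<forall>s\<in>states M. \<forall>a\<in>actions M. set_pmf (trans M s a) \<subseteq> states M) \<and>
     0 \<le> disc M \<and> disc M < 1"

definition tabular :: "('s, 'a) mdp \<Rightarrow> bool" where
  "tabular M \<longleftrightarrow> mdp M \<and> finite (states M) \<and> finite (actions M)"

text \<open>A policy may be randomised and may depend on the whole past: it maps the list of the
  past state-action pairs (oldest first) and the current state to a distribution on actions.\<close>

type_synonym ('s, 'a) policy = "('s \<times> 'a) list \<Rightarrow> 's \<Rightarrow> 'a pmf"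

definition policies :: "('s, 'a) mdp \<Rightarrow> ('s, 'a) policy set" where
  "policies M = {\<pi>. \<forall>h\<in>lists (states M \<times> actions M). \<forall>s\<in>states M. set_pmf (\<pi> h s) \<subseteq> actions M}"

definition stationary :: "('s \<Rightarrow> 'a) \<Rightarrow> ('s, 'a) policy" where
  "stationary p = (\<lambda>h s. return_pmf (p s))"

text \<open>The law of the pair \<open>(s\<^sub>t, a\<^sub>t)\<close> given the pairs \<open>\<omega> 0, \<dots>, \<omega> (t - 1)\<close>, started in \<open>s0\<close>.\<close>

definition step :: "('s, 'a) mdp \<Rightarrow> ('s, 'a) policy \<Rightarrow> 's \<Rightarrow> nat \<Rightarrow> (nat \<Rightarrow> 's \<times> 'a) \<Rightarrow> ('s \<times> 'a) pmf" where
  "step M \<pi> s0 t \<omega> =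
     bind_pmf (case t of 0 \<Rightarrow> return_pmf s0 | Suc u \<Rightarrow> trans M (fst (\<omega> u)) (snd (\<omega> u)))
       (\<lambda>s. map_pmf (Pair s) (\<pi> (map \<omega> [0..<t]) s))"

text \<open>The law of the infinite state-action sequence, by the Ionescu-Tulcea construction.\<close>

definition pair_space :: "('s, 'a) mdp \<Rightarrow> nat \<Rightarrow> ('s \<times> 'a) measure" where
  "pair_space M = (\<lambda>_. count_space (states M \<times> actions M))"

definition step_measure ::
  "('s, 'a) mdp \<Rightarrow> ('s, 'a) policy \<Rightarrow> 's \<Rightarrow> nat \<Rightarrow> (nat \<Rightarrow> 's \<times> 'a) \<Rightarrow> ('s \<times> 'a) measure" where
  "step_measure M \<pi> s0 t \<omega> = restrict_space (measure_pmf (step M \<pi> s0 t \<omega>)) (states M \<times> actions M)"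

definition traj :: "('s, 'a) mdp \<Rightarrow> ('s, 'a) policy \<Rightarrow> 's \<Rightarrow> (nat \<Rightarrow> 's \<times> 'a) measure" where
  "traj M \<pi> s0 =
     projective_family.lim UNIV (Ionescu_Tulcea.CI (step_measure M \<pi> s0) (pair_space M)) (pair_space M)"

definition val :: "('s, 'a) mdp \<Rightarrow> ('s, 'a) policy \<Rightarrow> 's \<Rightarrow> real" where
  "val M \<pi> s = (\<integral>\<omega>. (\<Sum>t. disc M ^ t * rew M (fst (\<omega> t)) (snd (\<omega> t))) \<partial>traj M \<pi> s)"

definition opt_val :: "('s, 'a) mdp \<Rightarrow> 's \<Rightarrow> real" where
  "opt_val M s = (SUP \<pi>\<in>policies M. val M \<pi> s)"


section \<open>R-MAX\<close>

text \<open>The maximal reward is 1 throughout, so that the maximal value is \<open>1 / (1 - \<gamma>)\<close>.\<close>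

record ('s, 'a) rmax_memory =
  visits  :: "'s \<Rightarrow> 'a \<Rightarrow> nat"
  succs   :: "'s \<Rightarrow> 'a \<Rightarrow> 's \<Rightarrow> nat"
  rew_sum :: "'s \<Rightarrow> 'a \<Rightarrow> real"
  qval    :: "'s \<Rightarrow> 'a \<Rightarrow> real"

text \<open>One synchronous sweep of value iteration in the empirical \<open>m\<close>-known model. The learner uses
  only the state set, the action set and the discount factor of \<open>M\<close>.\<close>

definition sweep ::
  "('s, 'a) mdp \<Rightarrow> nat \<Rightarrow> ('s, 'a) rmax_memory \<Rightarrow> ('s \<Rightarrow> 'a \<Rightarrow> real) \<Rightarrow> 's \<Rightarrow> 'a \<Rightarrow> real" where
  "sweep M m c Q s a =
     (if m \<le> visits c s a
      then rew_sum c s a / real (visits c s a)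
           + disc M * (\<Sum>s'\<in>states M. real (succs c s a s') / real (visits c s a) * Max (Q s' ` actions M))
      else 1 + disc M * Max (Q s ` actions M))"

definition vmax_table :: "('s, 'a) mdp \<Rightarrow> 's \<Rightarrow> 'a \<Rightarrow> real" where
  "vmax_table M = (\<lambda>_ _. 1 / (1 - disc M))"

definition num_sweeps :: "('s, 'a) mdp \<Rightarrow> real \<Rightarrow> nat" where
  "num_sweeps M \<epsilon>1 = nat \<lceil>ln (1 / (\<epsilon>1 * (1 - disc M))) / (1 - disc M)\<rceil>"

text \<open>Each recomputation starts afresh from the optimistic table, not from the previous one.\<close>

definition value_iteration ::
  "('s, 'a) mdp \<Rightarrow> nat \<Rightarrow> real \<Rightarrow> ('s, 'a) rmax_memory \<Rightarrow> 's \<Rightarrow> 'a \<Rightarrow> real" where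
  "value_iteration M m \<epsilon>1 c = (sweep M m c ^^ num_sweeps M \<epsilon>1) (vmax_table M)"

definition rmax_init :: "('s, 'a) mdp \<Rightarrow> ('s, 'a) rmax_memory" where
  "rmax_init M = \<lparr>visits = (\<lambda>_ _. 0), succs = (\<lambda>_ _ _. 0), rew_sum = (\<lambda>_ _. 0), qval = vmax_table M\<rparr>"

definition record_visit :: "'s \<Rightarrow> 'a \<Rightarrow> real \<Rightarrow> 's \<Rightarrow> ('s, 'a) rmax_memory \<Rightarrow> ('s, 'a) rmax_memory" where
  "record_visit s a r s' c = c\<lparr>
     visits  := (visits c)(s := (visits c s)(a := visits c s a + 1)),
     succs   := (succs c)(s := (succs c s)(a := (succs c s a)(s' := succs c s a s' + 1))),
     rew_sum := (rew_sum c)(s := (rew_sum c s)(a := rew_sum c s a + r))\<rparr>"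

text \<open>The effect of observing a transition from \<open>s\<close> to \<open>s'\<close> under action \<open>a\<close> with reward \<open>r\<close>.\<close>

definition rmax_update ::
  "('s, 'a) mdp \<Rightarrow> nat \<Rightarrow> real \<Rightarrow> 's \<Rightarrow> 'a \<Rightarrow> real \<Rightarrow> 's \<Rightarrow> ('s, 'a) rmax_memory \<Rightarrow> ('s, 'a) rmax_memory" where
  "rmax_update M m \<epsilon>1 s a r s' c =
     (if visits c s a < m
      then let c' = record_visit s a r s' c
           in if visits c' s a = m then c'\<lparr>qval := value_iteration M m \<epsilon>1 c'\<rparr> else c'
      else c)"

text \<open>The observed transitions \<open>((s\<^sub>i, a\<^sub>i), s\<^sub>i\<^sub>+\<^sub>1)\<close> of a history \<open>h\<close> that has led to state \<open>s\<close>.\<close>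

definition transitions :: "('s \<times> 'a) list \<Rightarrow> 's \<Rightarrow> (('s \<times> 'a) \<times> 's) list" where
  "transitions h s = zip h (tl (map fst h @ [s]))"

definition rmax_learn :: "('s, 'a) mdp \<Rightarrow> nat \<Rightarrow> real \<Rightarrow> ('s \<times> 'a) list \<Rightarrow> 's \<Rightarrow> ('s, 'a) rmax_memory" where
  "rmax_learn M m \<epsilon>1 h s =
     fold (\<lambda>((s, a), s'). rmax_update M m \<epsilon>1 s a (rew M s a) s') (transitions h s) (rmax_init M)"

definition rmax_table :: "('s, 'a) mdp \<Rightarrow> nat \<Rightarrow> real \<Rightarrow> ('s \<times> 'a) list \<Rightarrow> 's \<Rightarrow> 's \<Rightarrow> 'a \<Rightarrow> real" where
  "rmax_table M m \<epsilon>1 h s = qval (rmax_learn M m \<epsilon>1 h s)"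

text \<open>A greedy rule reads off a greedy action from an action-value table; it includes an arbitrary
  way of breaking ties.\<close>

definition greedy_rule :: "('s, 'a) mdp \<Rightarrow> (('s \<Rightarrow> 'a \<Rightarrow> real) \<Rightarrow> 's \<Rightarrow> 'a) \<Rightarrow> bool" where
  "greedy_rule M g \<longleftrightarrow>
     (\<forall>Q. \<forall>s\<in>states M. g Q s \<in> actions M \<and> (\<forall>a\<in>actions M. Q s a \<le> Q s (g Q s)))"

definition rmax ::
  "('s, 'a) mdp \<Rightarrow> nat \<Rightarrow> real \<Rightarrow> (('s \<Rightarrow> 'a \<Rightarrow> real) \<Rightarrow> 's \<Rightarrow> 'a) \<Rightarrow> ('s, 'a) policy" where
  "rmax M m \<epsilon>1 g = (\<lambda>h s. return_pmf (g (rmax_table M m \<epsilon>1 h s) s))"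

text \<open>The stationary policy, greedy for the current table, that R-MAX follows at time \<open>t\<close> of a run.\<close>

definition rmax_policy_at ::
  "('s, 'a) mdp \<Rightarrow> nat \<Rightarrow> real \<Rightarrow> (('s \<Rightarrow> 'a \<Rightarrow> real) \<Rightarrow> 's \<Rightarrow> 'a) \<Rightarrow> (nat \<Rightarrow> 's \<times> 'a) \<Rightarrow> nat \<Rightarrow> ('s, 'a) policy" where
  "rmax_policy_at M m \<epsilon>1 g \<omega> t = stationary (g (rmax_table M m \<epsilon>1 (map \<omega> [0..<t]) (fst (\<omega> t))))"


section \<open>The inner game and the Case II meta-game\<close>

text \<open>The agents are \<open>0, \<dots>, agents G - 1\<close>; all of them have the same action set.\<close>

record ('s, 'a) stochastic_game =
  agents   :: nat
  gstates  :: "'s set"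
  gactions :: "'a set"
  gtrans   :: "'s \<Rightarrow> (nat \<Rightarrow> 'a) \<Rightarrow> 's pmf"
  grew     :: "nat \<Rightarrow> 's \<Rightarrow> (nat \<Rightarrow> 'a) \<Rightarrow> real"

definition joint_actions :: "('s, 'a) stochastic_game \<Rightarrow> (nat \<Rightarrow> 'a) set" where
  "joint_actions G = (\<Pi>\<^sub>E i\<in>{..<agents G}. gactions G)"

definition inner_game :: "nat \<Rightarrow> ('s, 'a) stochastic_game \<Rightarrow> bool" where
  "inner_game hi G \<longleftrightarrow>
     1 \<le> agents G \<and> 1 \<le> hi \<and>
     finite (gstates G) \<and> gstates G \<noteq> {} \<and> finite (gactions G) \<and> gactions G \<noteq> {} \<and>
     (\<forall>s\<in>gstates G. \<forall>a\<in>joint_actions G.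
        set_pmf (gtrans G s a) \<subseteq> gstates G \<and>
        (\<forall>i<agents G. 0 \<le> grew G i s a \<and> grew G i s a \<le> 1 / real hi))"

abbreviation SA :: "('s, 'a) stochastic_game \<Rightarrow> nat" where
  "SA G \<equiv> card (gstates G) * card (gactions G)"

type_synonym ('s, 'a) qtable = "'s \<times> 'a \<Rightarrow> real"
type_synonym ('s, 'a) meta_state = "nat \<Rightarrow> nat \<Rightarrow> 's \<times> 'a"

definition qtables :: "('s, 'a) stochastic_game \<Rightarrow> ('s, 'a) qtable set" where
  "qtables G = (\<Pi>\<^sub>E x\<in>gstates G \<times> gactions G. {0..1})"

text \<open>A meta-state assigns to each agent \<open>i\<close> a trajectory of \<open>h\<close> (state, own action) pairs. Trajectories
  are taken at the full length \<open>h\<close> (shorter ones being padded), which gives exactly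
  \<open>(|S| |A|)\<^sup>n\<^sup>h\<close> meta-states.\<close>

definition meta_states :: "('s, 'a) stochastic_game \<Rightarrow> nat \<Rightarrow> ('s, 'a) meta_state set" where
  "meta_states G h = (\<Pi>\<^sub>E i\<in>{..<agents G}. \<Pi>\<^sub>E t\<in>{..<h}. gstates G \<times> gactions G)"

definition case_II_meta_mdp ::
  "('s, 'a) stochastic_game \<Rightarrow> nat \<Rightarrow> nat \<Rightarrow> (('s, 'a) meta_state, ('s, 'a) qtable) mdp \<Rightarrow> bool" where
  "case_II_meta_mdp G hi hm M \<longleftrightarrow>
     inner_game hi G \<and> 1 \<le> hm \<and> mdp M \<and>
     states M = meta_states G (hi * hm) \<and> actions M = qtables G \<and>
     (\<forall>s\<in>states M. \<forall>a\<in>actions M. 0 \<le> rew M s a \<and> rew M s a \<le> 1)"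


section \<open>Discretisation\<close>

definition grid_base :: "('s, 'a) stochastic_game \<Rightarrow> real \<Rightarrow> real" where
  "grid_base G side = 2 * sqrt (real (SA G)) / side + 1"

text \<open>The points of a net belong to a common, possibly translated, cubic grid of side \<open>side\<close>, and
  every Q-table is within one side length of the net in each coordinate.\<close>

definition cubic_grid_net :: "('s, 'a) stochastic_game \<Rightarrow> real \<Rightarrow> ('s, 'a) qtable set \<Rightarrow> bool" where
  "cubic_grid_net G side D \<longleftrightarrow>
     finite D \<and> D \<subseteq> qtables G \<and>
     (\<exists>z. \<forall>\<phi>\<in>D. \<forall>x\<in>gstates G \<times> gactions G. \<exists>j::int. \<phi> x = z x + of_int j * side) \<and>
     (\<forall>\<phi>\<in>qtables G. \<exists>\<psi>\<in>D. \<forall>x\<in>gstates G \<times> gactions G. \<bar>\<phi> x - \<psi> x\<bar> \<le> side) \<and>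
     real (card D) \<le> grid_base G side ^ SA G"

text \<open>The restriction of transitions and rewards to the actions in \<open>D\<close> is implicit, as an \<open>mdp\<close> is
  only ever inspected at its own states and actions.\<close>

definition discretise :: "('s, 'a) mdp \<Rightarrow> 'a set \<Rightarrow> ('s, 'a) mdp" where
  "discretise M D = M\<lparr>actions := D\<rparr>"

text \<open>The logarithms of the problem parameters, a power of which is hidden by a soft-O bound. All
  summands are nonnegative for \<open>0 < \<epsilon> < 1 / (1 - \<gamma>)\<close> and \<open>0 < \<delta> < 1\<close>.\<close>

definition log_factor :: "('s, 'a) stochastic_game \<Rightarrow> real \<Rightarrow> real \<Rightarrow> real \<Rightarrow> real \<Rightarrow> real" where
  "log_factor G side \<gamma> \<epsilon> \<delta> =
     1 + ln (real (SA G)) + ln (grid_base G side)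
       + ln (1 / (\<epsilon> * (1 - \<gamma>))) + ln (1 / (1 - \<gamma>)) + ln (1 / \<delta>)"


section \<open>The notions are well defined\<close>

lemma set_pmf_step:
  assumes M: "mdp M" and \<pi>: "\<pi> \<in> policies M" and s0: "s0 \<in> states M"
    and \<omega>: "\<And>u. u < t \<Longrightarrow> \<omega> u \<in> states M \<times> actions M"
  shows "set_pmf (step M \<pi> s0 t \<omega>) \<subseteq> states M \<times> actions M"
proof -
  have h: "map \<omega> [0..<t] \<in> lists (states M \<times> actions M)"
    using \<omega> by (auto simp: in_lists_conv_set)
  have "set_pmf (case t of 0 \<Rightarrow> return_pmf s0 | Suc u \<Rightarrow> trans M (fst (\<omega> u)) (snd (\<omega> u))) \<subseteq> states M"
  proof (cases t)
    case (Suc u)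
    then have "\<omega> u \<in> states M \<times> actions M" using \<omega> by simp
    then show ?thesis using M Suc by (auto simp: mdp_def mem_Times_iff)
  qed (use s0 in auto)
  moreover have "set_pmf (\<pi> (map \<omega> [0..<t]) s) \<subseteq> actions M" if "s \<in> states M" for s
    using \<pi> h that by (simp add: policies_def)
  ultimately show ?thesis
    unfolding step_def by (auto simp only: set_bind_pmf set_map_pmf UN_iff image_iff mem_Sigma_iff)
qed

lemma Ionescu_Tulcea_step_measure:
  assumes M: "tabular M" and \<pi>: "\<pi> \<in> policies M" and s0: "s0 \<in> states M"
  shows "Ionescu_Tulcea (step_measure M \<pi> s0) (pair_space M)"
proof (rule Ionescu_Tulcea.intro)
  let ?X = "states M \<times> actions M"
  have fin: "finite ?X" and mdp: "mdp M" using M by (auto simp: tabular_def)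
  have sp: "space (PiM {0..<i} (pair_space M)) = (\<Pi>\<^sub>E u\<in>{0..<i}. ?X)" for i
    by (simp add: space_PiM pair_space_def)
  have prob: "prob_space (step_measure M \<pi> s0 i x)" if "x \<in> space (PiM {0..<i} (pair_space M))" for i x
  proof -
    have "set_pmf (step M \<pi> s0 i x) \<subseteq> ?X"
      using that by (intro set_pmf_step[OF mdp \<pi> s0]) (auto simp: sp PiE_iff)
    then have "emeasure (measure_pmf (step M \<pi> s0 i x)) ?X = 1"
      by (intro measure_pmf.emeasure_eq_1_AE) (auto simp: AE_measure_pmf_iff)
    then show ?thesis
      by (intro prob_spaceI) (simp add: step_measure_def space_restrict_space emeasure_restrict_space)
  qed
  show "prob_space (step_measure M \<pi> s0 i x)" if "x \<in> space (PiM {0..<i} (pair_space M))" for i x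
    using prob that .
  show "step_measure M \<pi> s0 i \<in> measurable (PiM {0..<i} (pair_space M)) (subprob_algebra (pair_space M i))" for i
  proof -
    have eq: "PiM {0..<i} (pair_space M) = count_space (\<Pi>\<^sub>E u\<in>{0..<i}. ?X)"
      unfolding pair_space_def by (rule count_space_PiM_finite) (auto simp: fin countable_finite)
    have "sets (step_measure M \<pi> s0 i x) = sets (pair_space M i)" for x
      by (auto simp: step_measure_def pair_space_def sets_restrict_space)
    then have "step_measure M \<pi> s0 i x \<in> space (subprob_algebra (pair_space M i))"
      if "x \<in> (\<Pi>\<^sub>E u\<in>{0..<i}. ?X)" for x
      using prob[of x i] that unfolding sp space_subprob_algebra
      by (simp add: prob_space_imp_subprob_space)
    then show ?thesis
      unfolding eq by (simp add: measurable_count_space_eq1 Pi_iff)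
  qed
qed

lemma prob_space_traj:
  assumes "tabular M" "\<pi> \<in> policies M" "s0 \<in> states M"
  shows "prob_space (traj M \<pi> s0)"
proof -
  interpret Ionescu_Tulcea "step_measure M \<pi> s0" "pair_space M"
    by (rule Ionescu_Tulcea_step_measure[OF assms])
  have t: "traj M \<pi> s0 = PF.lim" by (simp add: traj_def)
  interpret C: prob_space "CI {}" by (rule PF.prob_space_P) auto
  have "emeasure PF.lim (PF.emb UNIV {} (space (CI {}))) = 1"
    by (subst lim) (simp_all add: C.emeasure_space_1 PF.sets_P[symmetric])
  moreover have "PF.emb UNIV {} (space (CI {})) = space PF.lim"
    by (auto simp: PF.space_P prod_emb_def space_PiM)
  ultimately show ?thesis unfolding t by (intro prob_spaceI) simp
qed

lemma card_meta_states: "card (meta_states G h) = SA G ^ (agents G * h)"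
  by (simp add: meta_states_def card_PiE card_cartesian_product power_mult mult.commute[of "agents G"])

lemma cubic_grid_net_exists:
  assumes G: "inner_game hi G" and side: "0 < side"
  shows "cubic_grid_net G side {\<phi>\<in>qtables G. \<forall>x\<in>gstates G \<times> gactions G. \<exists>j::int. \<phi> x = of_int j * side}"
    (is "cubic_grid_net G side ?D")
proof -
  let ?X = "gstates G \<times> gactions G"
  let ?I = "{0..1} \<inter> range (\<lambda>j::int. of_int j * side)"
  let ?J = "(\<lambda>j::int. of_int j * side) ` {0..\<lfloor>1 / side\<rfloor>}"
  have fX: "finite ?X" and cX: "card ?X = SA G" and pos: "1 \<le> SA G"
    using G by (auto simp: inner_game_def card_cartesian_product Suc_le_eq card_gt_0_iff)
  have D: "?D = (\<Pi>\<^sub>E x\<in>?X. ?I)"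
    unfolding qtables_def PiE_iff set_eq_iff mem_Collect_eq Int_iff image_iff by auto
  have IJ: "?I \<subseteq> ?J"
  proof
    fix y assume "y \<in> ?I"
    then obtain j :: int where j: "y = of_int j * side" "0 \<le> y" "y \<le> 1" by auto
    then have "0 \<le> j" "of_int j \<le> 1 / side" using side by (auto simp: field_simps zero_le_mult_iff)
    then show "y \<in> ?J" using j by (auto simp: le_floor_iff)
  qed
  have fI: "finite ?I" using IJ by (rule finite_subset) auto
  have "card ?I \<le> card ?J" using IJ by (rule card_mono[rotated]) auto
  also have "\<dots> \<le> card {0..\<lfloor>1 / side\<rfloor>}" by (rule card_image_le) auto
  finally have "real (card ?I) \<le> real (nat (\<lfloor>1 / side\<rfloor> + 1))" by simp
  also have "\<dots> = of_int \<lfloor>1 / side\<rfloor> + 1" using side by simp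
  also have "\<dots> \<le> 1 / side + 1" by simp
  also have "\<dots> \<le> 2 * sqrt (real (SA G)) / side + 1"
  proof -
    have "1 \<le> sqrt (real (SA G))" using pos by (metis of_nat_1 of_nat_mono real_sqrt_ge_one)
    then have "1 \<le> 2 * sqrt (real (SA G))" by linarith
    then show ?thesis using side by (intro add_right_mono divide_right_mono) simp_all
  qed
  finally have cI: "real (card ?I) \<le> grid_base G side" by (simp add: grid_base_def)
  have "real (card ?D) \<le> grid_base G side ^ SA G"
    unfolding D using fX cI by (simp add: card_PiE cX power_mono)
  moreover have "\<exists>\<psi>\<in>?D. \<forall>x\<in>?X. \<bar>\<phi> x - \<psi> x\<bar> \<le> side" if \<phi>: "\<phi> \<in> qtables G" for \<phi>
  proof -
    let ?f = "\<lambda>y. of_int \<lfloor>y / side\<rfloor> * side"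
    let ?\<psi> = "\<lambda>x\<in>?X. ?f (\<phi> x)"
    have b: "0 \<le> \<phi> x" "\<phi> x \<le> 1" if "x \<in> ?X" for x
      using \<phi> that by (auto simp: qtables_def PiE_iff)
    have f: "?f y \<le> y" "y - side \<le> ?f y" for y
    proof -
      show "?f y \<le> y"
        using mult_right_mono[OF of_int_floor_le[of "y / side"], of side] side by simp
      have "y / side - 1 \<le> of_int \<lfloor>y / side\<rfloor>" by linarith
      then show "y - side \<le> ?f y" using side by (simp add: field_simps)
    qed
    have "?f (\<phi> x) \<in> ?I" if "x \<in> ?X" for x
      using b[OF that] f(1)[of "\<phi> x"] side by auto
    then have "?\<psi> \<in> ?D" unfolding D by auto
    moreover have "\<bar>\<phi> x - ?\<psi> x\<bar> \<le> side" if "x \<in> ?X" for x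
      using that f[of "\<phi> x"] by (auto simp: abs_le_iff)
    ultimately show ?thesis by blast
  qed
  moreover have "finite ?D" unfolding D using fX fI by (intro finite_PiE) auto
  moreover have "\<exists>z. \<forall>\<phi>\<in>?D. \<forall>x\<in>?X. \<exists>j::int. \<phi> x = z x + of_int j * side"
    by (rule exI[of _ "\<lambda>_. 0"]) auto
  ultimately show ?thesis
    unfolding cubic_grid_net_def by (intro conjI) auto
qed

lemma tabular_discretise:
  assumes M: "case_II_meta_mdp G hi hm M" and D: "cubic_grid_net G side D"
  shows "tabular (discretise M D)"
proof -
  have "qtables G \<noteq> {}" by (auto simp: qtables_def PiE_eq_empty_iff)
  then have "D \<noteq> {}" using D by (auto simp: cubic_grid_net_def)
  moreover have "finite (meta_states G (hi * hm))"
    using M by (auto simp: case_II_meta_mdp_def inner_game_def meta_states_def intro!: finite_PiE)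
  moreover have "D \<subseteq> qtables G" "finite D" using D by (auto simp: cubic_grid_net_def)
  ultimately show ?thesis
    using M unfolding tabular_def mdp_def case_II_meta_mdp_def discretise_def
    by (simp, metis subsetD)
qed

lemma rmax_in_policies:
  assumes "greedy_rule M g"
  shows "rmax M m \<epsilon>1 g \<in> policies M"
  using assms by (auto simp: greedy_rule_def rmax_def policies_def)

end

theory Submission
  imports Defs
begin

text \<open>
  Suppose that the empirical transition frequencies of all known pairs are accurate. Then the
  table is optimistic, and the greedy policy falls short of its own table only by
  \<open>1 / (1 - \<gamma>)\<close> times the escape value, i.e. the expectation of \<open>\<gamma>\<^sup>\<tau>\<close>, where \<open>\<tau>\<close> is the first time
  at which the current greedy policy meets an unknown pair. Hence a bad timestep is one at which the
  escape value is at least of order \<open>\<epsilon> (1 - \<gamma>)\<close>.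

  Accuracy follows from an exponential supermartingale per pair and per set of successor states
  (Hoeffding's lemma) and a union bound. The bad timesteps are counted without splitting time
  into blocks of length \<open>1 / (1 - \<gamma>)\<close>: along known pairs the escape value grows in conditional
  mean by the factor \<open>1 / \<gamma>\<close>, and it lies in \<open>[0, 1]\<close>, so a visit to an unknown pair lowers it by
  at most 1. A second exponential supermartingale therefore bounds the sum of all
  escape values by about \<open>1 / (1 - \<gamma>)\<close> times the number of visits to unknown pairs.
\<close>

section \<open>The law of finite histories\<close>

text \<open>The learner keeps changing its table, so no single policy governs a long stretch of the
  run, and the escape value may jump when a pair becomes known. Two facts tame this. Learning leaves
  the counts of known pairs untouched, so accuracy at one memory passes to all earlier ones: the
  union bound ranges over pairs and sets of successors but not over time, and its
  \<open>2 ^ card S\<close> sets are the reason why \<open>m\<close> is of the order of the number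
  of states. And every change of the memory is a visit to an unknown pair, of which there are at
  most \<open>m * (card S * card A)\<close>, so each jump is charged to one such visit.
  \<open>opt_val\<close> ranges over randomised policies that depend on the past, and
  \<open>val\<close> integrates over infinite sequences; both are reached through Bellman
  inequalities, by discounted supermartingales on finite histories. Such histories have laws of
  finite support, so integrability is automatic, and the infinite horizon enters only through limits
  of truncated returns and of decreasing events.\<close>

lemma expectation_bind_finite:
  fixes f :: "'b \<Rightarrow> real"
  assumes "finite (set_pmf p)" "\<And>x. x \<in> set_pmf p \<Longrightarrow> finite (set_pmf (q x))"
  shows "measure_pmf.expectation (bind_pmf p q) f
    = measure_pmf.expectation p (\<lambda>x. measure_pmf.expectation (q x) f)"
  using assms by (simp add: pmf_expectation_bind[where A="set_pmf p"] integral_measure_pmf[where A="set_pmf p"])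

lemma expectation_mono_pmf:
  fixes f g :: "'b \<Rightarrow> real"
  assumes "finite (set_pmf p)" "\<And>x. x \<in> set_pmf p \<Longrightarrow> f x \<le> g x"
  shows "measure_pmf.expectation p f \<le> measure_pmf.expectation p g"
  using assms by (intro integral_mono_AE integrable_measure_pmf_finite) (auto simp: AE_measure_pmf_iff)

lemma expectation_cong_pmf:
  fixes f g :: "'b \<Rightarrow> real"
  assumes "\<And>x. x \<in> set_pmf p \<Longrightarrow> f x = g x"
  shows "measure_pmf.expectation p f = measure_pmf.expectation p g"
  using assms by (intro integral_cong_AE) (auto simp: AE_measure_pmf_iff)

lemma pmf_prob_le_expectation:
  fixes f :: "'b \<Rightarrow> real"
  assumes fin: "finite (set_pmf p)" and f: "\<And>x. x \<in> set_pmf p \<Longrightarrow> 0 \<le> f x"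
    and c: "\<And>x. x \<in> set_pmf p \<Longrightarrow> x \<in> E \<Longrightarrow> c \<le> f x"
  shows "c * measure_pmf.prob p E \<le> measure_pmf.expectation p f"
proof -
  have "c * measure_pmf.prob p E = measure_pmf.expectation p (\<lambda>x. c * indicator E x)" by simp
  also have "\<dots> \<le> measure_pmf.expectation p f"
    using f c by (intro expectation_mono_pmf fin) (auto simp: indicator_def)
  finally show ?thesis .
qed

definition list_step :: "('s, 'a) mdp \<Rightarrow> ('s, 'a) policy \<Rightarrow> 's \<Rightarrow> ('s \<times> 'a) list \<Rightarrow> ('s \<times> 'a) pmf" where
  "list_step M \<pi> s0 h =
     bind_pmf (if h = [] then return_pmf s0 else trans M (fst (last h)) (snd (last h)))
       (\<lambda>s. map_pmf (Pair s) (\<pi> h s))"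

primrec hist :: "('s, 'a) mdp \<Rightarrow> ('s, 'a) policy \<Rightarrow> 's \<Rightarrow> nat \<Rightarrow> ('s \<times> 'a) list pmf" where
  "hist M \<pi> s0 0 = return_pmf []"
| "hist M \<pi> s0 (Suc n) =
     bind_pmf (hist M \<pi> s0 n) (\<lambda>h. map_pmf (\<lambda>x. h @ [x]) (list_step M \<pi> s0 h))"

lemma step_eq_list_step: "step M \<pi> s0 t \<omega> = list_step M \<pi> s0 (map \<omega> [0..<t])"
  by (cases t) (simp_all add: step_def list_step_def)

lemma length_hist: "h \<in> set_pmf (hist M \<pi> s0 n) \<Longrightarrow> length h = n"
  by (induction n arbitrary: h) auto

lemma set_pmf_list_step:
  assumes M: "mdp M" and \<pi>: "\<pi> \<in> policies M" and s0: "s0 \<in> states M"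
    and h: "h \<in> lists (states M \<times> actions M)"
  shows "set_pmf (list_step M \<pi> s0 h) \<subseteq> states M \<times> actions M"
proof -
  have "set_pmf (step M \<pi> s0 (length h) ((!) h)) \<subseteq> states M \<times> actions M"
    using h by (intro set_pmf_step[OF M \<pi> s0]) (auto simp: in_lists_conv_set)
  then show ?thesis by (simp add: step_eq_list_step map_nth)
qed

lemma hist_in_lists:
  assumes M: "mdp M" and \<pi>: "\<pi> \<in> policies M" and s0: "s0 \<in> states M"
  shows "h \<in> set_pmf (hist M \<pi> s0 n) \<Longrightarrow> h \<in> lists (states M \<times> actions M)"
proof (induction n arbitrary: h)
  case (Suc n)
  then obtain h' x where h': "h' \<in> set_pmf (hist M \<pi> s0 n)" "x \<in> set_pmf (list_step M \<pi> s0 h')" "h = h' @ [x]"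
    by auto
  with Suc.IH[OF h'(1)] set_pmf_list_step[OF M \<pi> s0, of h'] show ?case by (auto simp del: split_paired_All simp: subset_iff)
qed auto

text \<open>Over a finite alphabet there are finitely many lists of length \<open>n\<close>, so a
  preimage is a finite union of cylinders. A general index set \<open>I\<close> serves both the
  finite products of the construction and the full product.\<close>

lemma measurable_prefix:
  assumes fin: "finite X" and I: "{0..<n} \<subseteq> I"
  shows "(\<lambda>\<omega>. map \<omega> [0..<n]) \<in> measurable (PiM I (\<lambda>_. count_space X)) (count_space UNIV)"
proof -
  let ?N = "PiM I (\<lambda>_. count_space X)"
  have fL: "finite {l. set l \<subseteq> X \<and> length l = n}" by (rule finite_lists_length_eq[OF fin])
  have "(\<lambda>\<omega>. map \<omega> [0..<n]) -` A \<inter> space ?N \<in> sets ?N" for A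
  proof -
    have "(\<lambda>\<omega>. map \<omega> [0..<n]) -` A \<inter> space ?N =
      (\<Union>l\<in>A \<inter> {l. set l \<subseteq> X \<and> length l = n}. {\<omega>\<in>space ?N. \<forall>i<n. \<omega> i = l ! i})"
    proof (intro equalityI subsetI)
      fix \<omega> assume "\<omega> \<in> (\<lambda>\<omega>. map \<omega> [0..<n]) -` A \<inter> space ?N"
      then have *: "\<omega> \<in> space ?N" "map \<omega> [0..<n] \<in> A" by auto
      have "\<omega> i \<in> X" if "i < n" for i
        using *(1) I that by (auto simp: space_PiM PiE_iff)
      then have "set (map \<omega> [0..<n]) \<subseteq> X" by auto
      with * show "\<omega> \<in> (\<Union>l\<in>A \<inter> {l. set l \<subseteq> X \<and> length l = n}. {\<omega>\<in>space ?N. \<forall>i<n. \<omega> i = l ! i})"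
        by (intro UN_I[of "map \<omega> [0..<n]"]) simp_all
    next
      fix \<omega> assume "\<omega> \<in> (\<Union>l\<in>A \<inter> {l. set l \<subseteq> X \<and> length l = n}. {\<omega>\<in>space ?N. \<forall>i<n. \<omega> i = l ! i})"
      then obtain l where l: "l \<in> A" "length l = n" "\<omega> \<in> space ?N" "\<forall>i<n. \<omega> i = l ! i" by auto
      then have "map \<omega> [0..<n] = l" by (intro nth_equalityI) auto
      with l show "\<omega> \<in> (\<lambda>\<omega>. map \<omega> [0..<n]) -` A \<inter> space ?N" by auto
    qed
    also have "\<dots> \<in> sets ?N"
    proof (rule sets.finite_UN)
      show "finite (A \<inter> {l. set l \<subseteq> X \<and> length l = n})" using fL by simp
      fix l assume l: "l \<in> A \<inter> {l. set l \<subseteq> X \<and> length l = n}"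
      have "{\<omega>\<in>space ?N. \<forall>i\<in>{..<n}. \<omega> i = l ! i} \<in> sets ?N"
      proof (cases "n = 0")
        case False
        show ?thesis
        proof (rule sets.sets_Collect_finite_All')
          fix i assume "i \<in> {..<n}"
          then have "i \<in> I" using I by auto
          then have m: "(\<lambda>\<omega>. \<omega> i) \<in> measurable ?N (count_space X)" by (rule measurable_component_singleton)
          have "(\<lambda>\<omega>. \<omega> i) -` ({l ! i} \<inter> X) \<inter> space ?N \<in> sets ?N"
            by (rule measurable_sets[OF m]) auto
          moreover have "(\<lambda>\<omega>. \<omega> i) -` ({l ! i} \<inter> X) \<inter> space ?N = {\<omega> \<in> space ?N. \<omega> i = l ! i}"
            using \<open>i \<in> I\<close> by (auto simp: space_PiM intro: PiE_mem)
          ultimately show "{\<omega> \<in> space ?N. \<omega> i = l ! i} \<in> sets ?N" by simp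
        qed (use False in auto)
      qed simp
      then show "{\<omega>\<in>space ?N. \<forall>i<n. \<omega> i = l ! i} \<in> sets ?N" by (simp only: Ball_def lessThan_iff)
    qed
    finally show ?thesis .
  qed
  then show ?thesis by (simp add: measurable_def)
qed

context
  fixes M :: "('s, 'a) mdp" and \<pi> s0
  assumes M: "tabular M" and \<pi>: "\<pi> \<in> policies M" and s0: "s0 \<in> states M"
begin

interpretation IT: Ionescu_Tulcea "step_measure M \<pi> s0" "pair_space M"
  by (rule Ionescu_Tulcea_step_measure[OF M \<pi> s0])

lemma sets_traj: "sets (traj M \<pi> s0) = sets (PiM UNIV (pair_space M))"
  unfolding traj_def by (rule IT.PF.sets_lim)

lemma space_traj: "space (traj M \<pi> s0) = (UNIV \<rightarrow> states M \<times> actions M)"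
  using sets_eq_imp_space_eq[OF sets_traj] by (simp add: space_PiM pair_space_def PiE_UNIV_domain)

private lemma finX: "finite (states M \<times> actions M)" and mdp: "mdp M"
  using M by (auto simp: tabular_def)

private lemma measurable_prefix': "{0..<n} \<subseteq> I \<Longrightarrow>
  (\<lambda>\<omega>. map \<omega> [0..<n]) \<in> measurable (PiM I (pair_space M)) (count_space UNIV)"
  unfolding pair_space_def by (rule measurable_prefix[OF finX])

text \<open>Restricting to \<open>states M \<times> actions M\<close> loses no mass because the
  support already lies there.\<close>

private lemma distr_step_measure:
  assumes "\<omega> \<in> space (PiM {0..<n} (pair_space M))"
  shows "distr (step_measure M \<pi> s0 n \<omega>) (count_space UNIV) f
    = measure_pmf (map_pmf f (list_step M \<pi> s0 (map \<omega> [0..<n])))" (is "?L = ?R")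
proof (rule measure_eqI)
  let ?X = "states M \<times> actions M"
  let ?p = "list_step M \<pi> s0 (map \<omega> [0..<n])"
  have "map \<omega> [0..<n] \<in> lists ?X"
    using assms by (auto simp: space_PiM PiE_iff pair_space_def in_lists_conv_set)
  from set_pmf_list_step[OF mdp \<pi> s0 this] have sub: "set_pmf ?p \<subseteq> ?X" .
  fix A :: "'b set"
  have "emeasure ?L A = emeasure (restrict_space (measure_pmf ?p) ?X) (f -` A \<inter> ?X)"
    by (subst emeasure_distr)
       (auto simp: step_measure_def step_eq_list_step space_restrict_space measurable_def sets_restrict_space)
  also have "\<dots> = emeasure (measure_pmf ?p) (f -` A \<inter> ?X)"
    by (subst emeasure_restrict_space) auto
  also have "\<dots> = emeasure (measure_pmf ?p) (f -` A)"
    by (rule emeasure_eq_AE) (use sub in \<open>auto simp: AE_measure_pmf_iff\<close>)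
  finally show "emeasure ?L A = emeasure ?R A" by (simp add: emeasure_map_pmf)
qed simp

text \<open>The Ionescu-Tulcea construction adds one coordinate per kernel step through
  \<open>fun_upd\<close>; read as lists, this appends one element, which is the recursion of
  \<open>hist\<close>.\<close>

private lemma distr_C: "distr (IT.C 0 n (\<lambda>_. undefined)) (count_space UNIV) (\<lambda>\<omega>. map \<omega> [0..<n])
    = measure_pmf (hist M \<pi> s0 n)"
proof (induction n)
  case 0
  have "(\<lambda>\<omega>. []) \<in> measurable (PiM {} (pair_space M)) (count_space UNIV)" by simp
  then show ?case
    by (simp add: distr_return space_PiM return_pmf.rep_eq)
next
  case (Suc n)
  let ?u = "\<lambda>_. undefined"
  let ?F = "\<lambda>h. measure_pmf (map_pmf (\<lambda>x. h @ [x]) (list_step M \<pi> s0 h))"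
  have u: "?u \<in> space (PiM {0..<0} (pair_space M))" by (simp add: space_PiM)
  have sp: "space (IT.C 0 n ?u) = space (PiM {0..<n} (pair_space M))"
    using IT.space_C[OF u, of n] by simp
  have sC: "sets (IT.C 0 n ?u) = sets (PiM {0..<n} (pair_space M))"
    using IT.sets_C[OF u, of n] by simp
  have mC: "measurable (IT.C 0 n ?u) N = measurable (PiM {0..<n} (pair_space M)) N" for N :: "'z measure"
    by (rule measurable_cong_sets[OF sC refl])
  have ne: "space (IT.C 0 n ?u) \<noteq> {}" using IT.prob_space_C[OF u] by (rule prob_space.not_empty)
  have "distr (IT.C 0 (Suc n) ?u) (count_space UNIV) (\<lambda>\<omega>. map \<omega> [0..<Suc n])
     = IT.C 0 n ?u \<bind> (\<lambda>\<omega>. distr (IT.eP n \<omega>) (count_space UNIV) (\<lambda>\<omega>. map \<omega> [0..<Suc n]))"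
    by (simp only: IT.C.simps add_0)
       (rule distr_bind[where K="PiM {0..<Suc n} (pair_space M)"], simp add: mC IT.measurable_eP,
         fact ne, intro measurable_prefix', simp)
  also have "\<dots> = IT.C 0 n ?u \<bind> (\<lambda>\<omega>. ?F (map \<omega> [0..<n]))"
  proof (rule bind_cong[OF refl])
    fix \<omega> assume "\<omega> \<in> space (IT.C 0 n ?u)"
    then have \<omega>: "\<omega> \<in> space (PiM {0..<n} (pair_space M))" by (simp add: sp)
    have m: "fun_upd \<omega> n \<in> measurable (step_measure M \<pi> s0 n \<omega>) (PiM {0..<Suc n} (pair_space M))"
    proof -
      have "fun_upd \<omega> n \<in> measurable (pair_space M n) (PiM {0..<Suc n} (pair_space M))"
        using \<omega> by (intro measurable_fun_upd[where J="{0..<n}"]) auto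
      then show ?thesis by (simp only: measurable_cong_sets[OF IT.sets_P[OF \<omega>] refl])
    qed
    have "distr (IT.eP n \<omega>) (count_space UNIV) (\<lambda>\<omega>. map \<omega> [0..<Suc n])
      = distr (step_measure M \<pi> s0 n \<omega>) (count_space UNIV) ((\<lambda>\<omega>. map \<omega> [0..<Suc n]) \<circ> fun_upd \<omega> n)"
      unfolding IT.eP_def by (rule distr_distr[OF measurable_prefix' m]) simp
    also have "(\<lambda>\<omega>. map \<omega> [0..<Suc n]) \<circ> fun_upd \<omega> n = (\<lambda>x. map \<omega> [0..<n] @ [x])"
      by (auto simp: fun_eq_iff)
    finally show "distr (IT.eP n \<omega>) (count_space UNIV) (\<lambda>\<omega>. map \<omega> [0..<Suc n]) = ?F (map \<omega> [0..<n])"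
      by (simp add: distr_step_measure[OF \<omega>])
  qed
  also have "\<dots> = distr (IT.C 0 n ?u) (count_space UNIV) (\<lambda>\<omega>. map \<omega> [0..<n]) \<bind> ?F"
  proof (rule bind_distr[symmetric, where K="count_space UNIV"])
    show "(\<lambda>\<omega>. map \<omega> [0..<n]) \<in> measurable (IT.C 0 n ?u) (count_space UNIV)"
      by (simp add: mC measurable_prefix')
    show "?F \<in> measurable (count_space UNIV) (subprob_algebra (count_space UNIV))"
      by (auto simp: space_subprob_algebra measure_pmf.subprob_space_axioms)
  qed (fact ne)
  also have "\<dots> = measure_pmf (hist M \<pi> s0 (Suc n))"
    by (simp add: Suc.IH measure_pmf_bind)
  finally show ?case .
qed

lemma measurable_prefix_traj:
  "(\<lambda>\<omega>. map \<omega> [0..<n]) \<in> measurable (traj M \<pi> s0) (count_space UNIV)"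
  by (simp only: measurable_cong_sets[OF sets_traj refl]) (rule measurable_prefix', simp)

text \<open>A prefix event is a cylinder over \<open>{0..<n}\<close>, where the projective limit
  agrees with the finite-dimensional law. Expectations and probabilities of runs reach
  \<open>hist\<close> only through this identity.\<close>

lemma distr_traj_prefix:
  "distr (traj M \<pi> s0) (count_space UNIV) (\<lambda>\<omega>. map \<omega> [0..<n]) = measure_pmf (hist M \<pi> s0 n)"
proof (rule measure_eqI)
  fix A
  let ?J = "{0..<n}" and ?u = "\<lambda>_. undefined"
  let ?X = "(\<lambda>\<omega>. map \<omega> [0..<n]) -` A \<inter> space (PiM ?J (pair_space M))"
  have u: "?u \<in> space (PiM {0..<0} (pair_space M))" by (simp add: space_PiM)
  have X: "?X \<in> sets (PiM ?J (pair_space M))"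
    by (rule measurable_sets[OF measurable_prefix']) auto
  have "emeasure (distr (traj M \<pi> s0) (count_space UNIV) (\<lambda>\<omega>. map \<omega> [0..<n])) A
     = emeasure (traj M \<pi> s0) ((\<lambda>\<omega>. map \<omega> [0..<n]) -` A \<inter> space (traj M \<pi> s0))"
    by (rule emeasure_distr[OF measurable_prefix_traj]) simp
  also have "(\<lambda>\<omega>. map \<omega> [0..<n]) -` A \<inter> space (traj M \<pi> s0) = IT.PF.emb UNIV ?J ?X"
  proof -
    have *: "map (restrict \<omega> ?J) [0..<n] = map \<omega> [0..<n]" for \<omega> :: "nat \<Rightarrow> 's \<times> 'a"
      by (rule map_cong) auto
    show ?thesis
      unfolding prod_emb_def vimage_def Int_iff mem_Collect_eq *
      by (auto simp: space_traj space_PiM PiE_iff pair_space_def Pi_iff)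
  qed
  also have "emeasure (traj M \<pi> s0) \<dots> = emeasure (IT.CI ?J) ?X"
    unfolding traj_def by (rule IT.lim[OF _ X]) simp
  also have "\<dots> = emeasure (IT.C 0 n ?u) (IT.PF.emb ?J ?J ?X)"
    by (rule IT.emeasure_CI[OF _ X]) simp
  also have "IT.PF.emb ?J ?J ?X = ?X"
    by (rule prod_emb_id) (auto simp: space_PiM)
  also have "emeasure (IT.C 0 n ?u) ?X =
      emeasure (distr (IT.C 0 n ?u) (count_space UNIV) (\<lambda>\<omega>. map \<omega> [0..<n])) A"
  proof (subst emeasure_distr)
    have sC: "sets (IT.C 0 n ?u) = sets (PiM {0..<n} (pair_space M))"
      using IT.sets_C[OF u, of n] by simp
    show "(\<lambda>\<omega>. map \<omega> [0..<n]) \<in> measurable (IT.C 0 n ?u) (count_space UNIV)"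
      by (simp only: measurable_cong_sets[OF sC refl] measurable_prefix'[OF order_refl])
    have "space (IT.C 0 n ?u) = space (PiM {0..<n} (pair_space M))"
      using IT.space_C[OF u, of n] by simp
    then show "emeasure (IT.C 0 n ?u) ?X = emeasure (IT.C 0 n ?u) ((\<lambda>\<omega>. map \<omega> [0..<n]) -` A \<inter> space (IT.C 0 n ?u))"
      by simp
  qed simp
  finally show "emeasure (distr (traj M \<pi> s0) (count_space UNIV) (\<lambda>\<omega>. map \<omega> [0..<n])) A
     = emeasure (measure_pmf (hist M \<pi> s0 n)) A"
    by (simp add: distr_C)
qed simp

lemma integral_traj_prefix:
  fixes f :: "('s \<times> 'a) list \<Rightarrow> real"
  shows "(\<integral>\<omega>. f (map \<omega> [0..<n]) \<partial>traj M \<pi> s0) = measure_pmf.expectation (hist M \<pi> s0 n) f"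
  unfolding distr_traj_prefix[symmetric]
  by (subst integral_distr[OF measurable_prefix_traj]) auto

lemma finite_list_step: "h \<in> lists (states M \<times> actions M) \<Longrightarrow> finite (set_pmf (list_step M \<pi> s0 h))"
  using set_pmf_list_step[OF _ \<pi> s0, of h] M
  by (auto simp: tabular_def intro: finite_subset[of _ "states M \<times> actions M"])

lemma finite_hist: "finite (set_pmf (hist M \<pi> s0 n))"
proof (rule finite_subset)
  show "set_pmf (hist M \<pi> s0 n) \<subseteq> {l. set l \<subseteq> states M \<times> actions M \<and> length l = n}"
    using hist_in_lists[OF _ \<pi> s0, of _ n] length_hist[of _ M \<pi> s0 n] M by (auto simp: tabular_def)
qed (use M in \<open>auto simp: tabular_def intro: finite_lists_length_eq\<close>)

lemma expectation_hist_Suc: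
  fixes f :: "('s \<times> 'a) list \<Rightarrow> real"
  shows "measure_pmf.expectation (hist M \<pi> s0 (Suc n)) f
    = measure_pmf.expectation (hist M \<pi> s0 n)
        (\<lambda>h. measure_pmf.expectation (list_step M \<pi> s0 h) (\<lambda>x. f (h @ [x])))"
  unfolding hist.simps
proof (subst expectation_bind_finite)
  show "finite (set_pmf (hist M \<pi> s0 n))" by (rule finite_hist)
  show "finite (set_pmf (map_pmf (\<lambda>x. h @ [x]) (list_step M \<pi> s0 h)))" if "h \<in> set_pmf (hist M \<pi> s0 n)" for h
    using finite_list_step[of h] hist_in_lists[OF _ \<pi> s0 that] M by (simp add: tabular_def)
qed simp

section \<open>Supermartingales on histories and Bellman inequalities\<close>

lemma hist_last:
  assumes "h \<in> set_pmf (hist M \<pi> s0 (Suc n))"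
  shows "h \<noteq> []" "last h \<in> states M \<times> actions M"
proof -
  show ne: "h \<noteq> []" using length_hist[OF assms] by auto
  have "h \<in> lists (states M \<times> actions M)" using hist_in_lists[OF _ \<pi> s0 assms] M by (auto simp: tabular_def)
  with ne show "last h \<in> states M \<times> actions M" using last_in_set[of h] by (auto simp del: split_paired_All)
qed

lemma expectation_hist_le:
  fixes f :: "('s \<times> 'a) list \<Rightarrow> real"
  assumes "\<And>n h. h \<in> set_pmf (hist M \<pi> s0 (Suc n)) \<Longrightarrow>
      measure_pmf.expectation (list_step M \<pi> s0 h) (\<lambda>x. f (h @ [x])) \<le> f h"
  shows "measure_pmf.expectation (hist M \<pi> s0 (Suc n)) f \<le> measure_pmf.expectation (hist M \<pi> s0 (Suc 0)) f"
proof (induction n)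
  case (Suc n)
  have "measure_pmf.expectation (hist M \<pi> s0 (Suc (Suc n))) f \<le> measure_pmf.expectation (hist M \<pi> s0 (Suc n)) f"
    unfolding expectation_hist_Suc[of "Suc n"]
    by (rule expectation_mono_pmf[OF finite_hist assms])
  with Suc.IH show ?case by linarith
qed simp

lemma expectation_hist_fst:
  fixes f :: "'s \<Rightarrow> real"
  shows "measure_pmf.expectation (hist M \<pi> s0 (Suc 0)) (\<lambda>h. f (fst (last h))) = f s0"
proof -
  have "measure_pmf.expectation (hist M \<pi> s0 (Suc 0)) (\<lambda>h. f (fst (last h)))
      = measure_pmf.expectation (hist M \<pi> s0 (Suc 0)) (\<lambda>h. f s0)"
    by (rule expectation_cong_pmf) (auto simp: list_step_def bind_return_pmf)
  then show ?thesis by simp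
qed

lemma list_step_nonempty: "h \<noteq> [] \<Longrightarrow>
  list_step M \<pi> s0 h = bind_pmf (trans M (fst (last h)) (snd (last h))) (\<lambda>s. map_pmf (Pair s) (\<pi> h s))"
  by (simp add: list_step_def)

lemma expectation_list_step_fst:
  fixes f :: "'s \<Rightarrow> real"
  assumes h: "h \<noteq> []"
  shows "measure_pmf.expectation (list_step M \<pi> s0 h) (\<lambda>x. f (fst x))
    = measure_pmf.expectation (trans M (fst (last h)) (snd (last h))) f"
proof -
  have "map_pmf fst (list_step M \<pi> s0 h) = trans M (fst (last h)) (snd (last h))"
    by (simp add: list_step_nonempty[OF h] map_bind_pmf pmf.map_comp comp_def map_pmf_const bind_return_pmf')
  then show ?thesis by (metis integral_map_pmf)
qed

text \<open>The return collected so far plus the discounted continuation \<open>U\<close> is a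
  supermartingale. Asking for the inequality only at pairs that end a possible history covers both
  arbitrary policies, where it holds for all actions, and a stationary policy, where it holds for
  the prescribed action alone.\<close>

lemma discounted_supersolution:
  fixes r :: "'s \<times> 'a \<Rightarrow> real" and U :: "'s \<Rightarrow> real"
  assumes U: "\<And>n h. h \<in> set_pmf (hist M \<pi> s0 (Suc n)) \<Longrightarrow>
      r (last h) + disc M * measure_pmf.expectation (trans M (fst (last h)) (snd (last h))) U \<le> U (fst (last h))"
  shows "measure_pmf.expectation (hist M \<pi> s0 (Suc n))
      (\<lambda>h. (\<Sum>u<n. disc M ^ u * r (h ! u)) + disc M ^ n * U (fst (last h))) \<le> U s0"
proof -
  \<comment> \<open>The reward of the last pair enters only with the next step, hence
    \<open>length h - 1\<close>.\<close>
  let ?f = "\<lambda>h. (\<Sum>u<length h - 1. disc M ^ u * r (h ! u)) + disc M ^ (length h - 1) * U (fst (last h))"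
  have "measure_pmf.expectation (hist M \<pi> s0 (Suc n)) ?f \<le> measure_pmf.expectation (hist M \<pi> s0 (Suc 0)) ?f"
  proof (rule expectation_hist_le)
    fix n h assume h: "h \<in> set_pmf (hist M \<pi> s0 (Suc n))"
    note ne = hist_last(1)[OF h] and len = length_hist[OF h]
    let ?p = "list_step M \<pi> s0 h"
    have fin: "finite (set_pmf ?p)"
      using hist_in_lists[OF _ \<pi> s0 h] M by (intro finite_list_step) (auto simp: tabular_def)
    have eq: "?f (h @ [x]) = (\<Sum>u<n. disc M ^ u * r (h ! u)) + disc M ^ n * (r (last h) + disc M * U (fst x))" for x
      using ne by (simp add: len nth_append last_conv_nth algebra_simps)
    have "measure_pmf.expectation ?p (\<lambda>x. ?f (h @ [x]))
      = (\<Sum>u<n. disc M ^ u * r (h ! u)) + disc M ^ n * (r (last h) + disc M * measure_pmf.expectation ?p (\<lambda>x. U (fst x)))"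
      unfolding eq by (simp add: integrable_measure_pmf_finite[OF fin])
    also have "\<dots> \<le> (\<Sum>u<n. disc M ^ u * r (h ! u)) + disc M ^ n * U (fst (last h))"
      unfolding expectation_list_step_fst[OF ne]
      using U[OF h] M by (intro add_left_mono mult_left_mono) (auto simp: tabular_def mdp_def)
    finally show "measure_pmf.expectation ?p (\<lambda>x. ?f (h @ [x])) \<le> ?f h" by (simp add: len)
  qed
  also have "measure_pmf.expectation (hist M \<pi> s0 (Suc n)) ?f = measure_pmf.expectation (hist M \<pi> s0 (Suc n))
      (\<lambda>h. (\<Sum>u<n. disc M ^ u * r (h ! u)) + disc M ^ n * U (fst (last h)))"
    using length_hist[of _ M \<pi> s0 "Suc n"] by (intro expectation_cong_pmf) simp
  also have "measure_pmf.expectation (hist M \<pi> s0 (Suc 0)) ?f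
      = measure_pmf.expectation (hist M \<pi> s0 (Suc 0)) (\<lambda>h. U (fst (last h)))"
    using length_hist[of _ M \<pi> s0 "Suc 0"] by (intro expectation_cong_pmf) simp
  also have "\<dots> = U s0" by (rule expectation_hist_fst)
  finally show ?thesis .
qed

lemma expectation_return_tendsto_val:
  assumes r: "\<And>s a. s \<in> states M \<Longrightarrow> a \<in> actions M \<Longrightarrow> \<bar>rew M s a\<bar> \<le> 1"
  shows "(\<lambda>n. measure_pmf.expectation (hist M \<pi> s0 (Suc n))
      (\<lambda>h. (\<Sum>u<n. disc M ^ u * rew M (fst (h ! u)) (snd (h ! u))))) \<longlonglongrightarrow> val M \<pi> s0"
proof -
  let ?T = "traj M \<pi> s0"
  let ?g = "\<lambda>u \<omega>. disc M ^ u * rew M (fst (\<omega> u)) (snd (\<omega> u))"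
  interpret prob_space ?T by (rule prob_space_traj[OF M \<pi> s0])
  have \<gamma>: "0 \<le> disc M" "disc M < 1" using M by (auto simp: tabular_def mdp_def)
  have meas: "(\<lambda>\<omega>. f (\<omega> u)) \<in> borel_measurable ?T" for u and f :: "'s \<times> 'a \<Rightarrow> real"
  proof -
    have "(\<lambda>\<omega>. f (map \<omega> [0..<Suc u] ! u)) \<in> borel_measurable ?T"
      by (rule measurable_compose[OF measurable_prefix_traj, of "\<lambda>h. f (h ! u)"]) simp
    then show ?thesis by (simp del: upt_Suc)
  qed
  have bound: "\<bar>?g u \<omega>\<bar> \<le> disc M ^ u" if "\<omega> \<in> space ?T" for u \<omega>
  proof -
    have "\<omega> u \<in> states M \<times> actions M" using that by (auto simp: space_traj)
    then have "\<bar>rew M (fst (\<omega> u)) (snd (\<omega> u))\<bar> \<le> 1" by (auto simp: mem_Times_iff intro: r)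
    then show ?thesis using \<gamma> by (simp add: abs_mult mult_left_le)
  qed
  have summ: "summable (\<lambda>u. ?g u \<omega>)" if "\<omega> \<in> space ?T" for \<omega>
    by (rule summable_comparison_test'[OF summable_geometric[of "disc M"]])
       (use \<gamma> bound[OF that] in auto)
  have "(\<lambda>n. \<integral>\<omega>. (\<Sum>u<n. ?g u \<omega>) \<partial>?T) \<longlonglongrightarrow> (\<integral>\<omega>. (\<Sum>u. ?g u \<omega>) \<partial>?T)"
  proof (rule integral_dominated_convergence[where w="\<lambda>_. 1 / (1 - disc M)"])
    show "(\<lambda>\<omega>. \<Sum>u. ?g u \<omega>) \<in> borel_measurable ?T"
      by (intro borel_measurable_suminf meas[of "\<lambda>x. c * rew M (fst x) (snd x)" for c])
    show "(\<lambda>\<omega>. \<Sum>u<n. ?g u \<omega>) \<in> borel_measurable ?T" for n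
      by (intro borel_measurable_sum meas[of "\<lambda>x. c * rew M (fst x) (snd x)" for c])
    show "AE \<omega> in ?T. (\<lambda>n. \<Sum>u<n. ?g u \<omega>) \<longlonglongrightarrow> (\<Sum>u. ?g u \<omega>)"
      by (intro AE_I2 summable_LIMSEQ summ)
    show "AE \<omega> in ?T. norm (\<Sum>u<n. ?g u \<omega>) \<le> 1 / (1 - disc M)" for n
    proof (rule AE_I2)
      fix \<omega> assume w: "\<omega> \<in> space ?T"
      have "\<bar>\<Sum>u<n. ?g u \<omega>\<bar> \<le> (\<Sum>u<n. disc M ^ u)"
        by (rule order_trans[OF sum_abs sum_mono[OF bound[OF w]]])
      also have "\<dots> \<le> (\<Sum>u. disc M ^ u)"
        using \<gamma> by (intro sum_le_suminf summable_geometric) auto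
      also have "\<dots> = 1 / (1 - disc M)" using \<gamma> by (intro suminf_geometric) auto
      finally show "norm (\<Sum>u<n. ?g u \<omega>) \<le> 1 / (1 - disc M)" by simp
    qed
  qed auto
  moreover have "(\<integral>\<omega>. (\<Sum>u<n. ?g u \<omega>) \<partial>?T) = measure_pmf.expectation (hist M \<pi> s0 (Suc n))
      (\<lambda>h. (\<Sum>u<n. disc M ^ u * rew M (fst (h ! u)) (snd (h ! u))))" for n
    unfolding integral_traj_prefix[symmetric]
    by (intro Bochner_Integration.integral_cong refl sum.cong) (simp_all add: nth_append)
  ultimately show ?thesis by (simp add: val_def)
qed

text \<open>The boundary term with \<open>disc M ^ n\<close> vanishes because \<open>U\<close> is
  bounded on finitely many states. The limit is a parameter \<open>v\<close> so that the negated
  reward, with limit \<open>- val\<close>, yields lower bounds as well.\<close>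

lemma discounted_supersolution_limit:
  fixes r :: "'s \<times> 'a \<Rightarrow> real" and U :: "'s \<Rightarrow> real"
  assumes U: "\<And>n h. h \<in> set_pmf (hist M \<pi> s0 (Suc n)) \<Longrightarrow>
      r (last h) + disc M * measure_pmf.expectation (trans M (fst (last h)) (snd (last h))) U \<le> U (fst (last h))"
    and lim: "(\<lambda>n. measure_pmf.expectation (hist M \<pi> s0 (Suc n)) (\<lambda>h. \<Sum>u<n. disc M ^ u * r (h ! u))) \<longlonglongrightarrow> v"
  shows "v \<le> U s0"
proof -
  have \<gamma>: "0 \<le> disc M" "disc M < 1" and fin: "finite (states M)" using M by (auto simp: tabular_def mdp_def)
  let ?A = "\<lambda>n. measure_pmf.expectation (hist M \<pi> s0 (Suc n)) (\<lambda>h. \<Sum>u<n. disc M ^ u * r (h ! u))"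
  let ?E = "\<lambda>n. measure_pmf.expectation (hist M \<pi> s0 (Suc n)) (\<lambda>h. U (fst (last h)))"
  define B where "B = (\<Sum>s\<in>states M. \<bar>U s\<bar>)"
  have "- B \<le> ?E n" for n
  proof -
    have "measure_pmf.expectation (hist M \<pi> s0 (Suc n)) (\<lambda>h. - B) \<le> ?E n"
    proof (rule expectation_mono_pmf[OF finite_hist])
      fix h assume "h \<in> set_pmf (hist M \<pi> s0 (Suc n))"
      then have "fst (last h) \<in> states M" using hist_last(2) by (auto simp: mem_Times_iff)
      then have "\<bar>U (fst (last h))\<bar> \<le> B" unfolding B_def by (rule member_le_sum) (auto simp: fin)
      then show "- B \<le> U (fst (last h))" by simp
    qed
    then show ?thesis by simp
  qed
  then have "?A n + disc M ^ n * (- B) \<le> ?A n + disc M ^ n * ?E n" for n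
    using \<gamma> by (intro add_left_mono mult_left_mono) auto
  also have "?A n + disc M ^ n * ?E n \<le> U s0" for n
  proof -
    have int: "integrable (measure_pmf (hist M \<pi> s0 (Suc n))) f" for f :: "_ \<Rightarrow> real"
      by (rule integrable_measure_pmf_finite[OF finite_hist])
    have "measure_pmf.expectation (hist M \<pi> s0 (Suc n))
      (\<lambda>h. (\<Sum>u<n. disc M ^ u * r (h ! u)) + disc M ^ n * U (fst (last h))) \<le> U s0"
      by (rule discounted_supersolution) (rule U)
    then show ?thesis by (simp add: int del: hist.simps)
  qed
  finally have "?A n + disc M ^ n * (- B) \<le> U s0" for n .
  moreover have "(\<lambda>n. ?A n + disc M ^ n * (- B)) \<longlonglongrightarrow> v + 0 * (- B)"
    using \<gamma> by (intro tendsto_intros lim LIMSEQ_power_zero) auto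
  ultimately show ?thesis by (intro LIMSEQ_le_const2[of "\<lambda>n. ?A n + disc M ^ n * (- B)" v]) auto
qed

lemma val_le_supersolution:
  assumes r: "\<And>s a. s \<in> states M \<Longrightarrow> a \<in> actions M \<Longrightarrow> \<bar>rew M s a\<bar> \<le> 1"
    and U: "\<And>s a. s \<in> states M \<Longrightarrow> a \<in> actions M \<Longrightarrow>
      rew M s a + disc M * measure_pmf.expectation (trans M s a) U \<le> U s"
  shows "val M \<pi> s0 \<le> U s0"
  by (rule discounted_supersolution_limit[OF _ expectation_return_tendsto_val[OF r]])
     (use hist_last(2) in \<open>auto simp: mem_Times_iff intro!: U\<close>)

end

text \<open>A Bellman inequality valid for every action survives any randomisation and any
  dependence on the past, so it bounds the supremum over all policies.\<close>

lemma opt_val_le_supersolution: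
  assumes M: "tabular M" and s: "s \<in> states M"
    and r: "\<And>s a. s \<in> states M \<Longrightarrow> a \<in> actions M \<Longrightarrow> \<bar>rew M s a\<bar> \<le> 1"
    and U: "\<And>s a. s \<in> states M \<Longrightarrow> a \<in> actions M \<Longrightarrow>
      rew M s a + disc M * measure_pmf.expectation (trans M s a) U \<le> U s"
  shows "opt_val M s \<le> U s"
  unfolding opt_val_def
proof (rule cSUP_least)
  obtain a where "a \<in> actions M" using M by (auto simp: tabular_def mdp_def)
  then have "stationary (\<lambda>_. a) \<in> policies M" by (auto simp: policies_def stationary_def)
  then show "policies M \<noteq> {}" by auto
qed (rule val_le_supersolution[OF M _ s r U])

text \<open>This is the upper bound applied to \<open>- F\<close> and the negated reward: along the
  histories of \<open>stationary p\<close> every action is the prescribed one.\<close>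

lemma subsolution_le_val_stationary:
  assumes M: "tabular M" and s: "s \<in> states M" and p: "\<And>s. s \<in> states M \<Longrightarrow> p s \<in> actions M"
    and r: "\<And>s a. s \<in> states M \<Longrightarrow> a \<in> actions M \<Longrightarrow> \<bar>rew M s a\<bar> \<le> 1"
    and F: "\<And>s. s \<in> states M \<Longrightarrow>
      F s \<le> rew M s (p s) + disc M * measure_pmf.expectation (trans M s (p s)) F"
  shows "F s \<le> val M (stationary p) s"
proof -
  have \<pi>: "stationary p \<in> policies M" using p by (auto simp: policies_def stationary_def)
  have "- val M (stationary p) s \<le> - F s"
  proof (rule discounted_supersolution_limit[OF M \<pi> s])
    fix n h assume h: "h \<in> set_pmf (hist M (stationary p) s (Suc n))"
    have "snd (last h) = p (fst (last h))"
      using h by (auto simp: list_step_def stationary_def)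
    moreover have "fst (last h) \<in> states M" using hist_last(2)[OF M \<pi> s h] by (auto simp: mem_Times_iff)
    ultimately show "- rew M (fst (last h)) (snd (last h)) + disc M *
        measure_pmf.expectation (trans M (fst (last h)) (snd (last h))) (\<lambda>s. - F s) \<le> - F (fst (last h))"
      using F[of "fst (last h)"] by simp
  next
    show "(\<lambda>n. measure_pmf.expectation (hist M (stationary p) s (Suc n))
      (\<lambda>h. \<Sum>u<n. disc M ^ u * - rew M (fst (h ! u)) (snd (h ! u)))) \<longlonglongrightarrow> - val M (stationary p) s"
      using tendsto_minus[OF expectation_return_tendsto_val[OF M \<pi> s r]]
      by (simp add: sum_negf)
  qed
  then show ?thesis by simp
qed

text \<open>The product of the right-hand side with \<open>1 + y + y\<^sup>2 / 2\<close>, a lower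
  bound of \<open>exp y\<close>, is \<open>1 + y ^ 4 / 4\<close>. The estimate controls the
  second-order term of the potential.\<close>

lemma exp_minus_le_quadratic:
  fixes y :: real
  assumes "0 \<le> y"
  shows "exp (- y) \<le> 1 - y + y\<^sup>2 / 2"
proof -
  have pos: "0 < 1 + y + y\<^sup>2 / 2" using assms by (simp add: add_pos_nonneg)
  have "(1 - y + y\<^sup>2 / 2) * (1 + y + y\<^sup>2 / 2) = 1 + (y\<^sup>2)\<^sup>2 / 4"
    by (simp add: field_simps power2_eq_square)
  then have "1 \<le> (1 - y + y\<^sup>2 / 2) * (1 + y + y\<^sup>2 / 2)" by simp
  then have "1 / (1 + y + y\<^sup>2 / 2) \<le> 1 - y + y\<^sup>2 / 2" using pos by (simp add: divide_le_eq)
  moreover have "exp (- y) \<le> 1 / (1 + y + y\<^sup>2 / 2)"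
    using exp_lower_Taylor_quadratic[OF assms] pos by (simp add: exp_minus inverse_eq_divide divide_left_mono)
  ultimately show ?thesis by linarith
qed

lemma sum_prefixes_snoc:
  fixes f :: "'b list \<Rightarrow> 'z :: comm_monoid_add"
  assumes "h \<noteq> []"
  shows "(\<Sum>u\<in>{1..<length (h @ [x])}. f (take u (h @ [x]))) = (\<Sum>u\<in>{1..<length h}. f (take u h)) + f h"
proof -
  have "{1..<length (h @ [x])} = insert (length h) {1..<length h}" using assms by (cases h) auto
  moreover have "(\<Sum>u\<in>{1..<length h}. f (take u (h @ [x]))) = (\<Sum>u\<in>{1..<length h}. f (take u h))"
    by (rule sum.cong) auto
  ultimately show ?thesis by (simp add: add.commute)
qed

text \<open>An infinite set has more than \<open>b\<close> elements below some \<open>T\<close>. The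
  right-hand side speaks of finite horizons only, which turns the final event into a countable
  intersection of prefix events.\<close>

lemma finite_card_le_iff:
  fixes b :: real and B :: "nat set"
  shows "finite B \<and> real (card B) \<le> b \<longleftrightarrow> (\<forall>T. real (card (B \<inter> {..<T})) \<le> b)"
proof (intro iffI allI conjI)
  fix T assume "finite B \<and> real (card B) \<le> b"
  then show "real (card (B \<inter> {..<T})) \<le> b"
    using card_mono[of B "B \<inter> {..<T}"] by force
next
  assume *: "\<forall>T. real (card (B \<inter> {..<T})) \<le> b"
  show "finite B"
  proof (rule ccontr)
    assume "infinite B"
    then obtain F where F: "finite F" "card F = Suc (nat \<lceil>b\<rceil>)" "F \<subseteq> B"
      using infinite_arbitrarily_large by blast
    from F(1) obtain T where "F \<subseteq> {..<T}" by (meson finite_nat_iff_bounded)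
    with F have "card F \<le> card (B \<inter> {..<T})" by (intro card_mono) auto
    with F(2) * have "real (Suc (nat \<lceil>b\<rceil>)) \<le> b" by (metis of_nat_le_iff order_trans)
    then show False by linarith
  qed
  then obtain T where "B \<subseteq> {..<T}" by (meson finite_nat_iff_bounded)
  then show "real (card B) \<le> b" using * by (metis inf.absorb1)
qed

section \<open>Value iteration in the empirical model\<close>

text \<open>For \<open>V\<close> between 0 and \<open>v\<close> the difference is largest when
  \<open>V\<close> is \<open>v\<close> where \<open>q\<close> exceeds \<open>p\<close> and 0
  elsewhere; one-sided control of sets thus controls all such sums.\<close>

lemma sum_diff_le_subset_sum:
  fixes p q V :: "'b \<Rightarrow> real"
  assumes fin: "finite S" and dev: "\<And>B. B \<subseteq> S \<Longrightarrow> sum q B - sum p B \<le> x"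
    and V: "\<And>s. s \<in> S \<Longrightarrow> 0 \<le> V s" "\<And>s. s \<in> S \<Longrightarrow> V s \<le> v" and v: "0 \<le> v"
  shows "(\<Sum>s\<in>S. q s * V s) - (\<Sum>s\<in>S. p s * V s) \<le> x * v"
proof -
  let ?B = "{s\<in>S. p s \<le> q s}"
  have "(\<Sum>s\<in>S. q s * V s) - (\<Sum>s\<in>S. p s * V s) = (\<Sum>s\<in>S. (q s - p s) * V s)"
    by (simp add: sum_subtractf left_diff_distrib)
  also have "\<dots> \<le> (\<Sum>s\<in>S. if p s \<le> q s then (q s - p s) * v else 0)"
    using V by (intro sum_mono) (auto intro: mult_left_mono mult_nonpos_nonneg)
  also have "\<dots> = (\<Sum>s\<in>?B. (q s - p s) * v)" using fin by (simp add: sum.inter_filter)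
  also have "\<dots> = (sum q ?B - sum p ?B) * v" by (simp only: sum_subtractf sum_distrib_right[symmetric])
  also have "\<dots> \<le> x * v" using v by (intro mult_right_mono dev) auto
  finally show ?thesis .
qed

text \<open>The memory held on reaching the last state of a nonempty history; the last action, although
  present in the list, has not been learned from yet.\<close>

definition memory :: "('s, 'a) mdp \<Rightarrow> nat \<Rightarrow> real \<Rightarrow> ('s \<times> 'a) list \<Rightarrow> ('s, 'a) rmax_memory" where
  "memory M m \<epsilon>1 h = rmax_learn M m \<epsilon>1 (butlast h) (fst (last h))"

lemma transitions_snoc: "transitions (h @ [x]) s = transitions h (fst x) @ [(x, s)]"
proof -
  have "tl (map fst (h @ [x]) @ [s]) = tl (map fst h @ [fst x]) @ [s]" by (cases h) auto
  moreover have "length h = length (tl (map fst h @ [fst x]))" by (cases h) auto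
  ultimately show ?thesis by (simp add: transitions_def)
qed

lemma memory_singleton: "memory M m \<epsilon>1 [x] = rmax_init M"
  by (simp add: memory_def rmax_learn_def transitions_def)

lemma memory_snoc:
  assumes "h \<noteq> []"
  shows "memory M m \<epsilon>1 (h @ [x]) =
    rmax_update M m \<epsilon>1 (fst (last h)) (snd (last h)) (rew M (fst (last h)) (snd (last h))) (fst x) (memory M m \<epsilon>1 h)"
proof -
  obtain h' s a where h: "h = h' @ [(s, a)]" using assms by (metis append_butlast_last_id prod.exhaust)
  have "butlast (h @ [x]) = h' @ [(s, a)]" unfolding h by (rule butlast_snoc)
  then show ?thesis unfolding memory_def by (simp add: h rmax_learn_def transitions_snoc)
qed

locale rmax_learner =
  fixes M :: "('s, 'a) mdp" and m :: nat and \<epsilon>1 :: real and g :: "('s \<Rightarrow> 'a \<Rightarrow> real) \<Rightarrow> 's \<Rightarrow> 'a"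
  assumes M: "tabular M" and m: "0 < m" and e1: "0 < \<epsilon>1" and g: "greedy_rule M g"
    and r: "\<And>s a. s \<in> states M \<Longrightarrow> a \<in> actions M \<Longrightarrow> 0 \<le> rew M s a \<and> rew M s a \<le> 1"
begin

abbreviation "S \<equiv> states M"
abbreviation "A \<equiv> actions M"
abbreviation "\<gamma> \<equiv> disc M"
abbreviation "Vm \<equiv> 1 / (1 - disc M)"
abbreviation update where "update s a \<equiv> rmax_update M m \<epsilon>1 s a (rew M s a)"
abbreviation known :: "('s, 'a) rmax_memory \<Rightarrow> 's \<Rightarrow> 'a \<Rightarrow> bool" where
  "known c s a \<equiv> m \<le> visits c s a"
abbreviation act :: "('s, 'a) rmax_memory \<Rightarrow> 's \<Rightarrow> 'a" where "act c s \<equiv> g (qval c) s"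
abbreviation mx :: "('s \<Rightarrow> 'a \<Rightarrow> real) \<Rightarrow> 's \<Rightarrow> real" where "mx Q s \<equiv> Max (Q s ` A)"

lemma finS: "finite S" and finA: "finite A" and neA: "A \<noteq> {}" and mdp: "mdp M"
  and \<gamma>: "0 \<le> \<gamma>" "\<gamma> < 1"
  using M by (auto simp: tabular_def mdp_def)

lemma Vm: "1 + \<gamma> * Vm = Vm" "0 < Vm"
  using \<gamma> by (auto simp: field_simps)

lemma trans_closed: "s \<in> S \<Longrightarrow> a \<in> A \<Longrightarrow> set_pmf (trans M s a) \<subseteq> S"
  using mdp by (auto simp: mdp_def)

lemma act: "s \<in> S \<Longrightarrow> act c s \<in> A" "s \<in> S \<Longrightarrow> a \<in> A \<Longrightarrow> qval c s a \<le> qval c s (act c s)"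
  using g by (auto simp: greedy_rule_def)

lemma expectation_trans:
  fixes f :: "'s \<Rightarrow> real"
  assumes "s \<in> S" "a \<in> A"
  shows "measure_pmf.expectation (trans M s a) f = (\<Sum>s'\<in>S. pmf (trans M s a) s' * f s')"
  using trans_closed[OF assms] by (subst integral_measure_pmf[OF finS]) auto

lemma fin_trans: "s \<in> S \<Longrightarrow> a \<in> A \<Longrightarrow> finite (set_pmf (trans M s a))"
  using trans_closed finS by (blast intro: finite_subset)

lemma sum_trans: "s \<in> S \<Longrightarrow> a \<in> A \<Longrightarrow> (\<Sum>s'\<in>S. pmf (trans M s a) s') = 1"
  using expectation_trans[of s a "\<lambda>_. 1"] by simp

lemma mx_act: "s \<in> S \<Longrightarrow> mx (qval c) s = qval c s (act c s)"
  using act finA by (intro Max_eqI) auto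

section \<open>The invariant of the learner's memory\<close>

definition consistent :: "('s, 'a) rmax_memory \<Rightarrow> bool" where
  "consistent c \<longleftrightarrow>
     (\<forall>s a. visits c s a \<le> m \<and> (\<Sum>s'\<in>S. succs c s a s') = visits c s a
        \<and> rew_sum c s a = real (visits c s a) * rew M s a)
     \<and> qval c = value_iteration M m \<epsilon>1 c"

lemma sweep_cong:
  assumes "\<And>s a. known c s a \<longleftrightarrow> known c' s a"
    and "\<And>s a. known c s a \<Longrightarrow> visits c s a = visits c' s a \<and> succs c s a = succs c' s a \<and> rew_sum c s a = rew_sum c' s a"
  shows "sweep M m c = sweep M m c'"
  using assms by (auto simp: sweep_def fun_eq_iff)

text \<open>As \<open>0 < m\<close>, no pair is known initially; the optimistic table is then a
  fixed point of the sweep and so counts as a result of value iteration.\<close>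

lemma consistent_init: "consistent (rmax_init M)"
proof -
  have "(sweep M m (rmax_init M) ^^ n) (vmax_table M) = vmax_table M" for n
  proof (induction n)
    case (Suc n)
    have "(\<lambda>_. Vm) ` A = {Vm}" using neA by auto
    then have "sweep M m (rmax_init M) (vmax_table M) = vmax_table M"
      using m Vm(1) by (auto simp: sweep_def fun_eq_iff rmax_init_def vmax_table_def)
    with Suc show ?case by simp
  qed simp
  then show ?thesis by (simp add: consistent_def value_iteration_def rmax_init_def)
qed

lemma update_known: "known c s a \<Longrightarrow> update s a s' c = c"
  by (simp add: rmax_update_def)

lemma update_simps:
  assumes "\<not> known c s a"
  shows "visits (update s a s' c) t b = visits c t b + (if t = s \<and> b = a then 1 else 0)"
    and "succs (update s a s' c) t b t' = succs c t b t' + (if t = s \<and> b = a \<and> t' = s' then 1 else 0)"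
    and "rew_sum (update s a s' c) t b = rew_sum c t b + (if t = s \<and> b = a then rew M s a else 0)"
  using assms by (auto simp: rmax_update_def record_visit_def Let_def)

lemma update_qval:
  assumes "\<not> known c s a"
  shows "qval (update s a s' c) =
    (if known (update s a s' c) s a then value_iteration M m \<epsilon>1 (update s a s' c) else qval c)"
proof -
  \<comment> \<open>The sweep never reads the stored table, so storing the new one does not affect
    what it was computed from.\<close>
  have "value_iteration M m \<epsilon>1 (c\<lparr>qval := q\<rparr>) = value_iteration M m \<epsilon>1 c" for c :: "('s, 'a) rmax_memory" and q
    unfolding value_iteration_def by (rule arg_cong2[of _ _ _ _ "\<lambda>f. (f ^^ _)"]) (auto intro: sweep_cong)
  then show ?thesis
    using assms by (auto simp: rmax_update_def record_visit_def Let_def not_le)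
qed

text \<open>The table is recomputed only when a pair becomes known, yet it always equals value
  iteration on the current counts: the sweep ignores the counts of unknown pairs, so the other
  updates do not change it.\<close>

lemma consistent_update:
  assumes c: "consistent c" and s': "s' \<in> S"
  shows "consistent (update s a s' c)"
proof (cases "known c s a")
  case False
  let ?c = "update s a s' c"
  have "visits ?c t b \<le> m \<and> (\<Sum>t'\<in>S. succs ?c t b t') = visits ?c t b
        \<and> rew_sum ?c t b = real (visits ?c t b) * rew M t b" for t b
    using c False s' finS
    by (auto simp: consistent_def update_simps[OF False] sum.distrib algebra_simps)
  moreover have "qval ?c = value_iteration M m \<epsilon>1 ?c"
  proof (cases "known ?c s a")
    case True then show ?thesis by (simp add: update_qval[OF False])
  next
    case nk: False
    have "sweep M m ?c = sweep M m c"
      using nk by (intro sweep_cong) (auto simp: update_simps[OF False] fun_eq_iff)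
    then have "value_iteration M m \<epsilon>1 ?c = value_iteration M m \<epsilon>1 c" by (simp add: value_iteration_def)
    then show ?thesis using c nk by (simp add: update_qval[OF False] consistent_def)
  qed
  ultimately show ?thesis by (simp add: consistent_def)
qed (use c in \<open>simp add: update_known\<close>)

text \<open>Dividing by \<open>m\<close> in place of the visit count makes this a frequency at known
  pairs only, where consistency forces the count to be \<open>m\<close>.\<close>

definition phat :: "('s, 'a) rmax_memory \<Rightarrow> 's \<Rightarrow> 'a \<Rightarrow> 's \<Rightarrow> real" where
  "phat c s a s' = real (succs c s a s') / real m"

lemma phat_nonneg: "0 \<le> phat c s a s'" by (simp add: phat_def)

lemma consistent_known:
  assumes "consistent c" "known c s a"
  shows "visits c s a = m" "sum (phat c s a) S = 1"
    and "sweep M m c Q s a = rew M s a + \<gamma> * (\<Sum>s'\<in>S. phat c s a s' * mx Q s')"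
proof -
  show v: "visits c s a = m" using assms by (simp add: consistent_def le_antisym)
  then have "(\<Sum>s'\<in>S. succs c s a s') = m" using assms by (simp add: consistent_def)
  then have "(\<Sum>s'\<in>S. real (succs c s a s')) = real m" by (metis of_nat_sum)
  then show "sum (phat c s a) S = 1" using m by (simp add: phat_def sum_divide_distrib[symmetric])
  show "sweep M m c Q s a = rew M s a + \<gamma> * (\<Sum>s'\<in>S. phat c s a s' * mx Q s')"
    using assms v m by (simp add: sweep_def phat_def consistent_def)
qed

section \<open>Monotonicity and contraction of value iteration\<close>

lemma mx_le_add:
  assumes "\<And>a. a \<in> A \<Longrightarrow> Q s a \<le> Q' s a + d"
  shows "mx Q s \<le> mx Q' s + d"
  using assms finA neA by (auto simp: Max_le_iff intro!: order_trans[OF assms] Max_ge)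

text \<open>With \<open>d = 0\<close> this is monotonicity, with \<open>d = \<gamma> ^ j\<close>
  contraction. The frequencies of a known pair sum to 1, so a constant passes through the
  average.\<close>

lemma sweep_le_add:
  assumes c: "consistent c" and Q: "\<And>s a. s \<in> S \<Longrightarrow> a \<in> A \<Longrightarrow> Q s a \<le> Q' s a + d"
    and s: "s \<in> S" "a \<in> A"
  shows "sweep M m c Q s a \<le> sweep M m c Q' s a + \<gamma> * d"
proof (cases "known c s a")
  case True
  have "(\<Sum>s'\<in>S. phat c s a s' * mx Q s') \<le> (\<Sum>s'\<in>S. phat c s a s' * (mx Q' s' + d))"
    using Q by (intro sum_mono mult_left_mono mx_le_add phat_nonneg) auto
  also have "\<dots> = (\<Sum>s'\<in>S. phat c s a s' * mx Q' s') + d"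
    using consistent_known(2)[OF c True]
    by (simp add: distrib_left sum.distrib sum_distrib_right[symmetric])
  finally show ?thesis
    using \<gamma> by (simp add: consistent_known(3)[OF c True] distrib_left[symmetric] mult_left_mono)
next
  case False
  have "mx Q s \<le> mx Q' s + d" using Q s by (intro mx_le_add) auto
  then have "\<gamma> * mx Q s \<le> \<gamma> * (mx Q' s + d)" using \<gamma> by (intro mult_left_mono)
  then show ?thesis using False by (simp add: sweep_def distrib_left)
qed

lemma sweep_vmax:
  assumes c: "consistent c" and s: "s \<in> S" "a \<in> A"
  shows "sweep M m c (vmax_table M) s a \<le> Vm" "Vm \<le> sweep M m c (vmax_table M) s a + 1"
proof -
  have "(\<lambda>_. Vm) ` A = {Vm}" using neA by auto
  then have "mx (vmax_table M) s' = Vm" for s' by (simp add: vmax_table_def)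
  then have "sweep M m c (vmax_table M) s a = (if known c s a then rew M s a + \<gamma> * Vm else Vm)"
    using consistent_known(2,3)[OF c, of s a] Vm(1)
    by (auto simp: sum_divide_distrib[symmetric]) (simp add: sweep_def)
  then show "sweep M m c (vmax_table M) s a \<le> Vm" "Vm \<le> sweep M m c (vmax_table M) s a + 1"
    using r[OF s] Vm(1) by auto
qed

text \<open>The first sweep lowers the optimistic table by at most 1; monotonicity and contraction
  propagate this to later sweeps. An unknown pair stays at \<open>Vm\<close> because it attains the
  maximum at its own state.\<close>

lemma iterate:
  assumes c: "consistent c" and s: "s \<in> S" "a \<in> A"
  defines "I \<equiv> \<lambda>j. (sweep M m c ^^ j) (vmax_table M)"
  shows "I (Suc j) s a \<le> I j s a" "I j s a \<le> I (Suc j) s a + \<gamma> ^ j" "I j s a \<le> Vm" "0 \<le> I j s a"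
    "\<not> known c s a \<Longrightarrow> I j s a = Vm"
proof -
  have dec: "I (Suc j) s a \<le> I j s a" if "s \<in> S" "a \<in> A" for s a j using that
  proof (induction j arbitrary: s a)
    case 0 then show ?case using sweep_vmax(1)[OF c 0] by (simp add: I_def vmax_table_def)
  next
    case (Suc j)
    then show ?case using sweep_le_add[OF c, of "I (Suc j)" "I j" 0 s a] by (simp add: I_def)
  qed
  show "I (Suc j) s a \<le> I j s a" by (rule dec[OF s])
  show "I j s a \<le> I (Suc j) s a + \<gamma> ^ j" using s
  proof (induction j arbitrary: s a)
    case 0 then show ?case using sweep_vmax(2)[OF c 0] by (simp add: I_def vmax_table_def)
  next
    case (Suc j)
    then show ?case using sweep_le_add[OF c, of "I j" "I (Suc j)" "\<gamma> ^ j" s a] by (simp add: I_def)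
  qed
  have le: "I j s a \<le> Vm" if "s \<in> S" "a \<in> A" for s a j
  proof (induction j)
    case (Suc j) then show ?case using dec[OF that, of j] by linarith
  qed (simp add: I_def vmax_table_def)
  show "I j s a \<le> Vm" by (rule le[OF s])
  show "0 \<le> I j s a" using s
  proof (induction j arbitrary: s a)
    case 0 then show ?case using Vm by (simp add: I_def vmax_table_def)
  next
    case (Suc j)
    have mx0: "0 \<le> mx (I j) s'" if "s' \<in> S" for s'
      using Suc.IH[OF that] neA finA by (meson Max_ge all_not_in_conv finite_imageI imageI order_trans)
    show ?case
    proof (cases "known c s a")
      case True
      have "0 \<le> (\<Sum>s'\<in>S. phat c s a s' * mx (I j) s')"
        by (intro sum_nonneg mult_nonneg_nonneg phat_nonneg mx0)
      then show ?thesis using consistent_known(3)[OF c True, of "I j"] r[OF Suc.prems] \<gamma> by (simp add: I_def)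
    next
      case False
      then show ?thesis using mx0[OF Suc.prems(1)] \<gamma> by (simp add: I_def sweep_def)
    qed
  qed
  show "I j s a = Vm" if nk: "\<not> known c s a"
  proof (induction j)
    case (Suc j)
    have "mx (I j) s = Vm"
      using Suc.IH s finA le[OF s(1)] by (intro Max_eqI) (auto simp: image_iff intro!: bexI[of _ a])
    then show ?case using nk Vm(1) by (simp add: I_def sweep_def)
  qed (simp add: I_def vmax_table_def)
qed

lemma power_num_sweeps: "\<gamma> ^ num_sweeps M \<epsilon>1 \<le> \<epsilon>1 * (1 - \<gamma>)"
proof -
  let ?J = "num_sweeps M \<epsilon>1"
  \<comment> \<open>This also covers a negative quotient, which \<open>nat\<close> turns into 0
    sweeps.\<close>
  have "ln (1 / (\<epsilon>1 * (1 - \<gamma>))) / (1 - \<gamma>) \<le> real ?J"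
    unfolding num_sweeps_def by linarith
  then have J: "ln (1 / (\<epsilon>1 * (1 - \<gamma>))) \<le> (1 - \<gamma>) * real ?J" using \<gamma> by (simp add: field_simps)
  have "\<gamma> \<le> exp (- (1 - \<gamma>))" using exp_ge_add_one_self[of "- (1 - \<gamma>)"] by simp
  then have "\<gamma> ^ ?J \<le> exp (- (1 - \<gamma>)) ^ ?J" using \<gamma> by (intro power_mono)
  also have "\<dots> = exp (- ((1 - \<gamma>) * real ?J))" by (simp add: exp_of_nat_mult[symmetric] algebra_simps)
  also have "\<dots> \<le> exp (- ln (1 / (\<epsilon>1 * (1 - \<gamma>))))" using J by simp
  also have "\<dots> = \<epsilon>1 * (1 - \<gamma>)" using e1 \<gamma> by (simp add: exp_minus)
  finally show ?thesis .
qed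

text \<open>The iterates decrease, so the table dominates its own sweep and optimism suffers nothing
  from stopping early. The next decrement, at most
  \<open>\<gamma> ^ num_sweeps M \<epsilon>1\<close>, bounds the gap in the other direction.\<close>

lemma qval_bounds:
  assumes c: "consistent c" and s: "s \<in> S" "a \<in> A"
  shows "0 \<le> qval c s a" "qval c s a \<le> Vm" "\<not> known c s a \<Longrightarrow> qval c s a = Vm"
    and "known c s a \<Longrightarrow> rew M s a + \<gamma> * (\<Sum>s'\<in>S. phat c s a s' * mx (qval c) s') \<le> qval c s a"
    and "known c s a \<Longrightarrow> qval c s a \<le>
      rew M s a + \<gamma> * (\<Sum>s'\<in>S. phat c s a s' * mx (qval c) s') + \<epsilon>1 * (1 - \<gamma>)"
proof -
  let ?J = "num_sweeps M \<epsilon>1"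
  have q: "qval c = (sweep M m c ^^ ?J) (vmax_table M)"
    using c by (simp add: consistent_def value_iteration_def)
  note it = iterate[OF c s, of ?J, folded q, unfolded funpow.simps comp_def, folded q]
  show "0 \<le> qval c s a" "qval c s a \<le> Vm" "\<not> known c s a \<Longrightarrow> qval c s a = Vm" using it by auto
  assume "known c s a"
  note sw = consistent_known(3)[OF c this, of "qval c"]
  show "rew M s a + \<gamma> * (\<Sum>s'\<in>S. phat c s a s' * mx (qval c) s') \<le> qval c s a"
    using it(1) sw by simp
  show "qval c s a \<le> rew M s a + \<gamma> * (\<Sum>s'\<in>S. phat c s a s' * mx (qval c) s') + \<epsilon>1 * (1 - \<gamma>)"
    using it(2) sw power_num_sweeps by simp
qed

section \<open>Escape values and regret\<close>

text \<open>The \<open>n\<close>-th iterate is the expectation of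
  \<open>\<gamma>\<^sup>\<tau>\<close> on the event that \<open>\<tau>\<close> is less than
  \<open>n\<close>, with the table of \<open>c\<close> frozen. The increasing limit gives the escape
  value without speaking of stopping times.\<close>

primrec escape_iter :: "('s, 'a) rmax_memory \<Rightarrow> nat \<Rightarrow> 's \<Rightarrow> real" where
  "escape_iter c 0 = (\<lambda>s. 0)"
| "escape_iter c (Suc n) = (\<lambda>s. if known c s (act c s)
     then \<gamma> * (\<Sum>s'\<in>S. pmf (trans M s (act c s)) s' * escape_iter c n s') else 1)"

definition escape :: "('s, 'a) rmax_memory \<Rightarrow> 's \<Rightarrow> real" where
  "escape c s = lim (\<lambda>n. escape_iter c n s)"

lemma escape_iter_nonneg: "0 \<le> escape_iter c n s"
  using \<gamma> by (induction n arbitrary: s) (auto intro!: sum_nonneg mult_nonneg_nonneg)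

lemma escape_iter_mono: "escape_iter c n s \<le> escape_iter c (Suc n) s"
proof (induction n arbitrary: s)
  case 0 show ?case using \<gamma> by (auto intro!: sum_nonneg mult_nonneg_nonneg)
next
  case (Suc n)
  show ?case using \<gamma> by (subst (1 2) escape_iter.simps) (auto intro!: sum_mono mult_left_mono Suc.IH simp del: escape_iter.simps)
qed

lemma escape_iter_le: "s \<in> S \<Longrightarrow> escape_iter c n s \<le> 1"
proof (induction n arbitrary: s)
  case (Suc n)
  have "(\<Sum>s'\<in>S. pmf (trans M s (act c s)) s' * escape_iter c n s') \<le> (\<Sum>s'\<in>S. pmf (trans M s (act c s)) s' * 1)"
    by (intro sum_mono mult_left_mono Suc.IH) auto
  also have "\<dots> = 1" using sum_trans[OF Suc.prems act(1)[OF Suc.prems]] by simp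
  finally have "\<gamma> * (\<Sum>s'\<in>S. pmf (trans M s (act c s)) s' * escape_iter c n s') \<le> 1 * 1"
    using \<gamma> by (intro mult_mono') (auto intro!: sum_nonneg mult_nonneg_nonneg escape_iter_nonneg)
  then show ?case by simp
qed simp

lemma escape_iter_lim: "s \<in> S \<Longrightarrow> (\<lambda>n. escape_iter c n s) \<longlonglongrightarrow> escape c s"
proof -
  assume s: "s \<in> S"
  have "incseq (\<lambda>n. escape_iter c n s)" by (intro incseq_SucI escape_iter_mono)
  moreover have "\<forall>n. escape_iter c n s \<le> 1" using escape_iter_le[OF s] by simp
  ultimately obtain L where "(\<lambda>n. escape_iter c n s) \<longlonglongrightarrow> L" by (rule incseq_convergent)
  then show ?thesis unfolding escape_def by (simp add: limI)
qed

lemma escape_range: assumes "s \<in> S" shows "0 \<le> escape c s" "escape c s \<le> 1"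
proof -
  show "0 \<le> escape c s"
    using escape_iter_nonneg by (intro LIMSEQ_le_const[OF escape_iter_lim[OF assms]]) auto
  show "escape c s \<le> 1"
    using escape_iter_le[OF assms] by (intro LIMSEQ_le_const2[OF escape_iter_lim[OF assms]]) auto
qed

lemma escape_unknown: 
  assumes "s \<in> S" "\<not> known c s (act c s)" shows "escape c s = 1"
proof (rule LIMSEQ_unique[OF escape_iter_lim[OF assms(1)]])
  have "(\<lambda>n. escape_iter c (Suc n) s) \<longlonglongrightarrow> 1" using assms by simp
  then show "(\<lambda>n. escape_iter c n s) \<longlonglongrightarrow> 1" by (subst (asm) filterlim_sequentially_Suc)
qed

lemma escape_known:
  assumes s: "s \<in> S" and k: "known c s (act c s)"
  shows "escape c s = \<gamma> * measure_pmf.expectation (trans M s (act c s)) (escape c)"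
proof (rule LIMSEQ_unique)
  show "(\<lambda>n. escape_iter c (Suc n) s) \<longlonglongrightarrow> escape c s"
    using escape_iter_lim[OF s] by (subst filterlim_sequentially_Suc)
  have "(\<lambda>n. \<gamma> * (\<Sum>s'\<in>S. pmf (trans M s (act c s)) s' * escape_iter c n s'))
     \<longlonglongrightarrow> \<gamma> * (\<Sum>s'\<in>S. pmf (trans M s (act c s)) s' * escape c s')"
    by (intro tendsto_intros escape_iter_lim)
  then show "(\<lambda>n. escape_iter c (Suc n) s) \<longlonglongrightarrow> \<gamma> * measure_pmf.expectation (trans M s (act c s)) (escape c)"
    using k expectation_trans[OF s act(1)[OF s]] by simp
qed

text \<open>For consistent memories the supremum over \<open>B\<close> is the total variation
  distance, as complements give the other sign. The form with sets suits a union bound over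
  \<open>Pow S\<close>.\<close>

definition accurate :: "real \<Rightarrow> ('s, 'a) rmax_memory \<Rightarrow> bool" where
  "accurate x c \<longleftrightarrow> (\<forall>s\<in>S. \<forall>a\<in>A. \<forall>B. B \<subseteq> S \<longrightarrow> known c s a \<longrightarrow>
     sum (phat c s a) B - measure_pmf.prob (trans M s a) B \<le> x)"

lemma accurate_expectation:
  assumes c: "consistent c" "accurate x c" and s: "s \<in> S" "a \<in> A" "known c s a"
    and V: "\<And>s. s \<in> S \<Longrightarrow> 0 \<le> V s" "\<And>s. s \<in> S \<Longrightarrow> V s \<le> v" and v: "0 \<le> v"
  shows "\<bar>(\<Sum>s'\<in>S. phat c s a s' * V s') - measure_pmf.expectation (trans M s a) V\<bar> \<le> x * v"
proof -
  let ?p = "pmf (trans M s a)"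
  have dev: "sum (phat c s a) B - sum ?p B \<le> x" if "B \<subseteq> S" for B
  proof -
    have "sum (phat c s a) B - measure_pmf.prob (trans M s a) B \<le> x"
      using c(2) s that by (auto simp: accurate_def)
    then show ?thesis by (simp add: measure_measure_pmf_finite[OF finite_subset[OF that finS]])
  qed
  \<comment> \<open>Both weights have total mass 1, so passing to the complement turns a deficit
    into an excess.\<close>
  have "sum ?p B - sum (phat c s a) B \<le> x" if B: "B \<subseteq> S" for B
  proof -
    have "sum ?p (S - B) = 1 - sum ?p B" "sum (phat c s a) (S - B) = 1 - sum (phat c s a) B"
      using sum_diff[OF finS B, of ?p] sum_diff[OF finS B, of "phat c s a"] sum_trans[OF s(1,2)]
        consistent_known(2)[OF c(1) s(3)] by auto
    with dev[of "S - B"] show ?thesis by auto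
  qed
  from sum_diff_le_subset_sum[OF finS dev V v] sum_diff_le_subset_sum[OF finS this V v]
  show ?thesis by (simp add: expectation_trans[OF s(1,2)] abs_le_iff)
qed

text \<open>Adding \<open>x * Vm\<^sup>2\<close>, a model error of \<open>x * Vm\<close> per step
  over the effective horizon \<open>Vm\<close>, turns the optimistic table into a Bellman
  supersolution for the true transitions. At unknown pairs the value \<open>Vm\<close> covers any
  reward and any successor.\<close>

lemma opt_val_le_table:
  assumes c: "consistent c" "accurate x c" and x: "0 \<le> x" and s: "s \<in> S"
  shows "opt_val M s \<le> mx (qval c) s + x * Vm\<^sup>2"
proof -
  let ?V = "mx (qval c)" and ?U = "\<lambda>s. mx (qval c) s + x * Vm\<^sup>2"
  have V: "0 \<le> ?V s" "?V s \<le> Vm" if "s \<in> S" for s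
    using qval_bounds(1,2)[OF c(1) that act(1)[OF that]] mx_act[OF that] by auto
  show ?thesis
  proof (rule opt_val_le_supersolution[OF M s])
    show "\<bar>rew M s a\<bar> \<le> 1" if "s \<in> S" "a \<in> A" for s a using r[OF that] by simp
  next
    fix s a assume s: "s \<in> S" "a \<in> A"
    have EU: "measure_pmf.expectation (trans M s a) ?U = measure_pmf.expectation (trans M s a) ?V + x * Vm\<^sup>2"
      by (simp add: integrable_measure_pmf_finite[OF fin_trans[OF s]])
    have mxQ: "qval c s a \<le> ?V s" using s finA by simp
    show "rew M s a + \<gamma> * measure_pmf.expectation (trans M s a) ?U \<le> ?U s"
    proof (cases "known c s a")
      case True
      have "\<bar>(\<Sum>s'\<in>S. phat c s a s' * ?V s') - measure_pmf.expectation (trans M s a) ?V\<bar> \<le> x * Vm"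
        using V Vm by (intro accurate_expectation[OF c s True]) auto
      then have "measure_pmf.expectation (trans M s a) ?V \<le> (\<Sum>s'\<in>S. phat c s a s' * ?V s') + x * Vm" by linarith
      from mult_left_mono[OF this \<gamma>(1)]
      have 1: "\<gamma> * measure_pmf.expectation (trans M s a) ?V
          \<le> \<gamma> * (\<Sum>s'\<in>S. phat c s a s' * ?V s') + \<gamma> * (x * Vm)" by (simp add: distrib_left)
      have "\<gamma> * (x * Vm) + \<gamma> * (x * Vm\<^sup>2) = x * Vm * (\<gamma> * (1 + Vm))"
        by (simp only: power2_eq_square distrib_left mult_ac mult_1_right)
      also have "\<dots> \<le> x * Vm * Vm"
      proof (rule mult_left_mono)
        have "\<gamma> * (1 + Vm) = \<gamma> + (Vm - 1)" using Vm(1) by (simp only: distrib_left mult_1_right)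
        then show "\<gamma> * (1 + Vm) \<le> Vm" using \<gamma> by linarith
        show "0 \<le> x * Vm" using x Vm(2) by simp
      qed
      finally have 2: "\<gamma> * (x * Vm) + \<gamma> * (x * Vm\<^sup>2) \<le> x * Vm\<^sup>2" by (simp only: power2_eq_square mult.assoc)
      show ?thesis unfolding EU distrib_left using 1 2 mxQ qval_bounds(4)[OF c(1) s True] by linarith
    next
      case False
      have "measure_pmf.expectation (trans M s a) ?V \<le> measure_pmf.expectation (trans M s a) (\<lambda>_. Vm)"
        using V trans_closed[OF s] by (intro expectation_mono_pmf fin_trans s) auto
      then have "\<gamma> * measure_pmf.expectation (trans M s a) ?V \<le> \<gamma> * Vm"
        using \<gamma>(1) by (intro mult_left_mono) auto
      moreover have "\<gamma> * (x * Vm\<^sup>2) \<le> 1 * (x * Vm\<^sup>2)"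
        using \<gamma> x Vm by (intro mult_right_mono) auto
      ultimately show ?thesis unfolding EU distrib_left
        using r[OF s] Vm(1) mxQ qval_bounds(3)[OF c(1) s False] by linarith
    qed
  qed
qed

text \<open>Up to accuracy, the greedy policy falls short of its own table only through the discounted
  probability of escaping to an unknown pair. Truncating at 0 makes the claimed lower bound a
  subsolution at the unknown pairs as well.\<close>
lemma table_le_val:
  assumes c: "consistent c" "accurate x c" and x: "0 \<le> x" and s: "s \<in> S"
  shows "mx (qval c) s - Vm * escape c s - (x * Vm\<^sup>2 + \<epsilon>1) \<le> val M (stationary (act c)) s"
proof -
  let ?V = "mx (qval c)"
  define k where "k = x * Vm\<^sup>2 + \<epsilon>1"
  let ?H = "\<lambda>s. ?V s - Vm * escape c s - k"
  let ?F = "\<lambda>s. max 0 (?H s)"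
  have V: "0 \<le> ?V s" "?V s \<le> Vm" if "s \<in> S" for s
    using qval_bounds(1,2)[OF c(1) that act(1)[OF that]] mx_act[OF that] by auto
  have k0: "0 \<le> k" using x e1 by (simp add: k_def)
  have "?F s \<le> val M (stationary (act c)) s"
  proof (rule subsolution_le_val_stationary[OF M s])
    show "act c s \<in> A" if "s \<in> S" for s using act(1)[OF that] .
    show "\<bar>rew M s a\<bar> \<le> 1" if "s \<in> S" "a \<in> A" for s a using r[OF that] by simp
  next
    fix s assume s: "s \<in> S"
    let ?a = "act c s"
    note a = act(1)[OF s, of c]
    let ?E = "measure_pmf.expectation (trans M s ?a)"
    have int: "integrable (measure_pmf (trans M s ?a)) f" for f :: "'s \<Rightarrow> real"
      by (rule integrable_measure_pmf_finite[OF fin_trans[OF s a]])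
    have F0: "0 \<le> rew M s ?a + \<gamma> * ?E ?F"
      using r[OF s a] \<gamma> by (intro add_nonneg_nonneg mult_nonneg_nonneg Bochner_Integration.integral_nonneg) auto
    show "?F s \<le> rew M s ?a + \<gamma> * ?E ?F"
    proof (cases "known c s ?a")
      case True
      have "\<bar>(\<Sum>s'\<in>S. phat c s ?a s' * ?V s') - ?E ?V\<bar> \<le> x * Vm"
        using V Vm by (intro accurate_expectation[OF c s a True]) auto
      then have "(\<Sum>s'\<in>S. phat c s ?a s' * ?V s') \<le> ?E ?V + x * Vm" by linarith
      from mult_left_mono[OF this \<gamma>(1)]
      have 1: "\<gamma> * (\<Sum>s'\<in>S. phat c s ?a s' * ?V s') \<le> \<gamma> * ?E ?V + \<gamma> * (x * Vm)" by (simp add: distrib_left)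
      have 2: "\<gamma> * (x * Vm) \<le> 1 * (x * Vm)"
        using \<gamma> x Vm by (intro mult_right_mono mult_nonneg_nonneg) auto
      \<comment> \<open>The constant \<open>k\<close> comes from this balance: one step of
        discounting releases \<open>(1 - \<gamma>) * k\<close>, which pays for the model error and
        for the residual of value iteration.\<close>
      have "(1 - \<gamma>) * k = x * Vm * ((1 - \<gamma>) * Vm) + \<epsilon>1 * (1 - \<gamma>)"
        by (simp only: k_def power2_eq_square distrib_left mult_ac)
      then have 3: "(1 - \<gamma>) * k = x * Vm + \<epsilon>1 * (1 - \<gamma>)" using \<gamma> by simp
      have "?E ?H = ?E ?V - Vm * ?E (escape c) - k" using int by simp
      then have 4: "\<gamma> * ?E ?H = \<gamma> * ?E ?V - Vm * escape c s - \<gamma> * k"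
        by (simp only: right_diff_distrib mult.left_commute[of \<gamma> Vm] escape_known[OF s True, symmetric])
      have "?E ?H \<le> ?E ?F" by (intro expectation_mono_pmf fin_trans s a) auto
      from mult_left_mono[OF this \<gamma>(1)] have 5: "\<gamma> * ?E ?H \<le> \<gamma> * ?E ?F" .
      have 6: "?V s = qval c s ?a" by (rule mx_act[OF s])
      have 7: "(1 - \<gamma>) * k = k - \<gamma> * k" by (simp add: left_diff_distrib)
      have "?H s \<le> rew M s ?a + \<gamma> * ?E ?F"
        using 1 2 3 4 5 6 7 qval_bounds(5)[OF c(1) s a True] by linarith
      with F0 show ?thesis by simp
    next
      case False
      then have "?H s \<le> 0" using escape_unknown[OF s] V(2)[OF s] k0 by simp
      with F0 show ?thesis by simp
    qed
  qed
  then show ?thesis unfolding k_def by simp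
qed

lemma regret_le_escape:
  assumes "consistent c" "accurate x c" "0 \<le> x" "s \<in> S"
  shows "opt_val M s - val M (stationary (act c)) s \<le> 2 * (x * Vm\<^sup>2) + \<epsilon>1 + Vm * escape c s"
  using opt_val_le_table[OF assms] table_le_val[OF assms] by linarith

section \<open>Supermartingales along a run\<close>

abbreviation "mem \<equiv> memory M m \<epsilon>1"
abbreviation "learner \<equiv> rmax M m \<epsilon>1 g"
abbreviation "nu c \<equiv> (\<Sum>y\<in>S \<times> A. visits c (fst y) (snd y))"

lemma learner: "learner \<in> policies M"
  by (rule rmax_in_policies[OF g])

text \<open>Known pairs leave the memory unchanged, so along a run \<open>nu\<close> counts the
  visits made so far to unknown pairs.\<close>

lemma nu_update:
  assumes "s \<in> S" "a \<in> A" "\<not> known c s a"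
  shows "nu (update s a s' c) = nu c + 1"
proof -
  have "nu (update s a s' c) = nu c + (\<Sum>y\<in>S \<times> A. if y = (s, a) then 1 else 0)"
    by (subst sum.distrib[symmetric], rule sum.cong)
       (auto simp: update_simps[OF assms(3)])
  also have "(\<Sum>y\<in>S \<times> A. if y = (s, a) then 1 else (0::nat)) = 1"
    using assms finS finA by (subst sum.delta) auto
  finally show ?thesis .
qed

lemma nu_le:
  assumes "consistent c"
  shows "nu c \<le> m * (card S * card A)"
proof -
  have "nu c \<le> (\<Sum>y\<in>S \<times> A. m)" using assms by (intro sum_mono) (simp add: consistent_def)
  then show ?thesis by (simp add: card_cartesian_product mult.commute)
qed

text \<open>Counts are frozen once a pair is known, and a later memory, with more known pairs,
  satisfies more constraints. Accuracy at the end of a horizon therefore covers all earlier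
  timesteps.\<close>

lemma accurate_update:
  assumes acc: "accurate x (update t b t' c)"
  shows "accurate x c"
proof (cases "known c t b")
  case False
  have "phat (update t b t' c) s a = phat c s a \<and> known (update t b t' c) s a" if "known c s a" for s a
    using that False by (auto simp: phat_def fun_eq_iff update_simps[OF False])
  then show ?thesis using acc unfolding accurate_def by metis
qed (use acc in \<open>simp add: update_known\<close>)

text \<open>The visit count times the probability compensates the number of successors in
  \<open>B\<close>; \<open>l\<^sup>2 / 8\<close> is Hoeffding's bound on the logarithmic moment
  generating function of a centred variable with range of length 1.\<close>

definition tilt :: "real \<Rightarrow> 's set \<Rightarrow> 's \<Rightarrow> 'a \<Rightarrow> ('s, 'a) rmax_memory \<Rightarrow> real" where
  "tilt l B s a c = exp (l * ((\<Sum>t\<in>B. real (succs c s a t)) - real (visits c s a) * measure_pmf.prob (trans M s a) B)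
      - l\<^sup>2 / 8 * real (visits c s a))"

text \<open>The weight moves only when the visited pair is \<open>(s, a)\<close> itself and still
  unknown. The visited pair is arbitrary, so the estimate is indifferent to how the learner selects
  its actions.\<close>

lemma tilt_supermartingale:
  assumes l: "0 \<le> l" and B: "finite B" and t: "t \<in> S" "b \<in> A"
  shows "measure_pmf.expectation (trans M t b) (\<lambda>t'. tilt l B s a (update t b t' c)) \<le> tilt l B s a c"
proof (cases "\<not> known c t b \<and> t = s \<and> b = a")
  case True
  let ?q = "measure_pmf.prob (trans M s a) B"
  have int: "integrable (measure_pmf (trans M s a)) f" for f :: "'s \<Rightarrow> real"
    using fin_trans[OF t] True by (auto intro: integrable_measure_pmf_finite)
  have eq: "tilt l B s a (update t b t' c)
      = tilt l B s a c * exp (- (l * ?q + l\<^sup>2 / 8)) * (1 + (exp l - 1) * indicator B t')" for t'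
  proof -
    have nk: "\<not> known c s a" using True by auto
    have "(\<Sum>u\<in>B. real (succs (update s a t' c) s a u))
        = (\<Sum>u\<in>B. real (succs c s a u) + (if u = t' then 1 else 0))"
      using nk by (intro sum.cong) (auto simp: update_simps[OF nk])
    also have "\<dots> = (\<Sum>u\<in>B. real (succs c s a u)) + indicator B t'"
      using B by (simp add: sum.distrib indicator_def)
    finally have 1: "(\<Sum>u\<in>B. real (succs (update s a t' c) s a u)) = (\<Sum>u\<in>B. real (succs c s a u)) + indicator B t'" .
    have 2: "real (visits (update s a t' c) s a) = real (visits c s a) + 1"
      by (simp add: update_simps[OF nk])
    have "tilt l B s a (update s a t' c) = tilt l B s a c * exp (- (l * ?q + l\<^sup>2 / 8)) * exp (l * indicator B t')"
      unfolding tilt_def 1 2 exp_add[symmetric] by (rule arg_cong[of _ _ exp]) (simp add: algebra_simps)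
    moreover have "exp (l * indicator B t') = 1 + (exp l - 1) * indicator B t'"
      by (simp add: indicator_def)
    ultimately show ?thesis using True by simp
  qed
  have "measure_pmf.expectation (trans M t b) (\<lambda>t'. tilt l B s a (update t b t' c))
      = tilt l B s a c * exp (- (l * ?q + l\<^sup>2 / 8)) * (1 + ?q * (exp l - 1))"
    unfolding eq using True int by simp
  \<comment> \<open>The left side is the moment generating function of a Bernoulli variable of mean
    \<open>?q\<close>.\<close>
  also have "1 + ?q * (exp l - 1) \<le> exp (l * ?q + l\<^sup>2 / 8)"
  proof -
    have pos: "0 < 1 + ?q * (exp l - 1)" using l by (intro add_pos_nonneg mult_nonneg_nonneg) auto
    have "ln (1 + ?q * (exp l - 1)) \<le> l * ?q + l\<^sup>2 / 8"
      using Hoeffdings_lemma_aux[OF l, of ?q] by simp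
    then show ?thesis using pos by (metis exp_le_cancel_iff exp_ln)
  qed
  then have "tilt l B s a c * exp (- (l * ?q + l\<^sup>2 / 8)) * (1 + ?q * (exp l - 1))
      \<le> tilt l B s a c * exp (- (l * ?q + l\<^sup>2 / 8)) * exp (l * ?q + l\<^sup>2 / 8)"
    by (intro mult_left_mono) (auto simp: tilt_def)
  also have "\<dots> = tilt l B s a c" by (simp only: mult.assoc mult_exp_exp) simp
  finally show ?thesis .
next
  case False
  have "tilt l B s a (update t b t' c) = tilt l B s a c" for t'
  proof (cases "known c t b")
    case nk: False
    then show ?thesis using False by (auto simp: tilt_def update_simps[OF nk])
  qed (simp add: update_known)
  then show ?thesis by simp
qed

section \<open>Escape sums, the potential and bad timesteps\<close>

definition escape_term :: "('s \<times> 'a) list \<Rightarrow> real" where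
  "escape_term h = (if known (mem h) (fst (last h)) (snd (last h)) then escape (mem h) (fst (last h)) else 0)"

definition escape_sum :: "('s \<times> 'a) list \<Rightarrow> real" where
  "escape_sum h = (\<Sum>u\<in>{1..<length h}. escape_term (take u h))"

lemma escape_sum_snoc: "h \<noteq> [] \<Longrightarrow> escape_sum (h @ [x]) = escape_sum h + escape_term h"
  unfolding escape_sum_def by (rule sum_prefixes_snoc)

text \<open>With \<open>l = 1 - \<gamma>\<close>, a step at a known pair raises the mean escape
  value by \<open>l\<close> times the mean of the next one. An exponential of tilt \<open>l\<close>
  loses at most half of this drift to its second-order term; the other half pays for the weight
  \<open>l / 2\<close> on \<open>escape_sum\<close>. A visit to an unknown pair, where
  \<open>escape_term\<close> is 0, is paid for by \<open>nu\<close>.\<close>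

definition potential :: "('s \<times> 'a) list \<Rightarrow> real" where
  "potential h = exp ((1 - \<gamma>) * ((1 - \<gamma>) / 2 * escape_sum h - real (nu (mem h)) - escape (mem h) (fst (last h))))"

definition bad :: "real \<Rightarrow> ('s \<times> 'a) list \<Rightarrow> bool" where
  "bad \<epsilon> h \<longleftrightarrow> \<not> opt_val M (fst (last h)) - val M (stationary (act (mem h))) (fst (last h)) \<le> \<epsilon>"

text \<open>A prefix of length \<open>u\<close> ends with the pair of timestep \<open>u - 1\<close>, and the last timestep of \<open>h\<close> itself
  is not counted.\<close>

definition num_bad :: "real \<Rightarrow> ('s \<times> 'a) list \<Rightarrow> nat" where
  "num_bad \<epsilon> h = (\<Sum>u\<in>{1..<length h}. of_bool (bad \<epsilon> (take u h)))"

lemma bad_prefix: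
  "bad \<epsilon> (map \<omega> [0..<Suc t]) \<longleftrightarrow>
    \<not> opt_val M (fst (\<omega> t)) - val M (rmax_policy_at M m \<epsilon>1 g \<omega> t) (fst (\<omega> t)) \<le> \<epsilon>"
  by (simp add: bad_def rmax_policy_at_def memory_def rmax_table_def)

lemma num_bad_prefix: "num_bad \<epsilon> (map \<omega> [0..<Suc T]) =
  card ({t. \<not> opt_val M (fst (\<omega> t)) - val M (rmax_policy_at M m \<epsilon>1 g \<omega> t) (fst (\<omega> t)) \<le> \<epsilon>} \<inter> {..<T})"
proof -
  have "num_bad \<epsilon> (map \<omega> [0..<Suc T]) = (\<Sum>u\<in>{1..<Suc T}. of_bool (bad \<epsilon> (map \<omega> [0..<u])))"
    unfolding num_bad_def by (rule sum.cong) (auto simp: take_map simp del: upt_Suc)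
  also have "\<dots> = (\<Sum>t<T. of_bool (bad \<epsilon> (map \<omega> [0..<Suc t])))"
    by (rule sum.reindex_bij_witness[of _ Suc "\<lambda>u. u - 1"]) (auto simp del: upt_Suc)
  also have "\<dots> = card ({t. bad \<epsilon> (map \<omega> [0..<Suc t])} \<inter> {..<T})"
    by (simp add: of_bool_def sum.If_cases Int_commute del: upt_Suc)
  finally show ?thesis by (simp only: bad_prefix)
qed

section \<open>Probability bounds for a run from a fixed initial state\<close>

context
  fixes s0 assumes s0: "s0 \<in> S"
begin

abbreviation "H \<equiv> \<lambda>n. hist M learner s0 (Suc n)"

lemma finH: "finite (set_pmf (H n))" by (rule finite_hist[OF M learner s0])

lemma hist_SucE:
  assumes "h \<in> set_pmf (H (Suc n))"
  obtains h' x where "h = h' @ [x]" "h' \<in> set_pmf (H n)" "h' \<noteq> []" "fst (last h') \<in> S" "snd (last h') \<in> A" "fst x \<in> S"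
    "mem h = update (fst (last h')) (snd (last h')) (fst x) (mem h')"
proof -
  from assms obtain h' x where h: "h' \<in> set_pmf (H n)" "h = h' @ [x]"
    unfolding hist.simps(2)[of M learner s0 "Suc n"] by (auto simp del: hist.simps)
  note l = hist_last[OF M learner s0 h(1)]
  have "fst x \<in> S" using hist_last(2)[OF M learner s0 assms] h(2) by (auto simp: mem_Times_iff)
  with h l show ?thesis using that by (simp add: memory_snoc mem_Times_iff)
qed

lemma consistent_mem: "h \<in> set_pmf (H n) \<Longrightarrow> consistent (mem h)"
proof (induction n arbitrary: h)
  case 0
  then show ?case by (auto simp: memory_singleton consistent_init)
next
  case (Suc n)
  from Suc.prems show ?case by (rule hist_SucE) (simp add: consistent_update Suc.IH)
qed

text \<open>Escape values are defined by the greedy action of the memory; this identifies it with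
  the action actually taken in the run.\<close>

lemma greedy_last:
  assumes "h \<in> set_pmf (H n)"
  shows "snd (last h) = act (mem h) (fst (last h))"
  using assms by (auto simp: list_step_def rmax_def memory_def rmax_table_def)

lemma expectation_step_fst:
  fixes f :: "'s \<Rightarrow> real"
  assumes "h \<in> set_pmf (H n)"
  shows "measure_pmf.expectation (list_step M learner s0 h) (\<lambda>x. f (fst x))
    = measure_pmf.expectation (trans M (fst (last h)) (snd (last h))) f"
  by (rule expectation_list_step_fst[OF M learner s0]) (rule hist_last(1)[OF M learner s0 assms])

lemma expectation_tilt_le:
  assumes l: "0 \<le> l" and B: "finite B"
  shows "measure_pmf.expectation (H n) (\<lambda>h. tilt l B s a (mem h)) \<le> 1"
proof -
  have "measure_pmf.expectation (H n) (\<lambda>h. tilt l B s a (mem h)) \<le> measure_pmf.expectation (H 0) (\<lambda>h. tilt l B s a (mem h))"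
  proof (rule expectation_hist_le[OF M learner s0])
    fix n h assume h: "h \<in> set_pmf (H n)"
    note hl = hist_last[OF M learner s0 h]
    show "measure_pmf.expectation (list_step M learner s0 h) (\<lambda>x. tilt l B s a (mem (h @ [x]))) \<le> tilt l B s a (mem h)"
      unfolding memory_snoc[OF hl(1)]
        expectation_step_fst[OF h, of "\<lambda>s'. tilt l B s a (update (fst (last h)) (snd (last h)) s' (mem h))"]
      using hl(2) by (intro tilt_supermartingale[OF l B]) (auto simp: mem_Times_iff)
  qed
  also have "\<dots> = measure_pmf.expectation (H 0) (\<lambda>h. 1)"
    by (rule expectation_cong_pmf) (auto simp: memory_singleton tilt_def rmax_init_def)
  finally show ?thesis by simp
qed

text \<open>Chernoff's bound. The time at which \<open>(s, a)\<close> becomes known is random, but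
  counting stops there, so the sample size on this event is exactly \<open>m\<close> and the bound
  is the same for every \<open>n\<close>.\<close>

lemma prob_deviation_le:
  assumes x: "0 \<le> x" and B: "finite B"
  shows "measure_pmf.prob (H n) {h. known (mem h) s a \<and> x < sum (phat (mem h) s a) B - measure_pmf.prob (trans M s a) B}
    \<le> exp (- (2 * real m * x\<^sup>2))" (is "measure_pmf.prob _ ?E \<le> _")
proof -
  let ?q = "measure_pmf.prob (trans M s a) B"
  \<comment> \<open>The tilt \<open>4 * x\<close> maximises
    \<open>l * m * x - l\<^sup>2 * m / 8\<close>, with value
    \<open>2 * m * x\<^sup>2\<close>.\<close>
  have "exp (2 * real m * x\<^sup>2) * measure_pmf.prob (H n) ?E
      \<le> measure_pmf.expectation (H n) (\<lambda>h. tilt (4 * x) B s a (mem h))"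
  proof (rule pmf_prob_le_expectation[OF finH])
    fix h assume h: "h \<in> set_pmf (H n)" "h \<in> ?E"
    then have v: "visits (mem h) s a = m" using consistent_known(1)[OF consistent_mem[OF h(1)]] by auto
    have "real m * x \<le> real m * (sum (phat (mem h) s a) B - ?q)"
      using h(2) by (intro mult_left_mono) auto
    also have "\<dots> = (\<Sum>t\<in>B. real (succs (mem h) s a t)) - real m * ?q"
      using m by (simp add: phat_def sum_divide_distrib[symmetric] right_diff_distrib)
    finally have "4 * x * (real m * x) \<le> 4 * x * ((\<Sum>t\<in>B. real (succs (mem h) s a t)) - real m * ?q)"
      using x by (intro mult_left_mono) auto
    then show "exp (2 * real m * x\<^sup>2) \<le> tilt (4 * x) B s a (mem h)"
      by (simp add: tilt_def v power2_eq_square algebra_simps)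
  qed (simp add: tilt_def)
  also have "\<dots> \<le> 1" using x B by (intro expectation_tilt_le) auto
  finally show ?thesis by (simp add: exp_minus field_simps)
qed

lemma prob_not_accurate_le:
  assumes x: "0 \<le> x"
  shows "measure_pmf.prob (H n) {h. \<not> accurate x (mem h)}
    \<le> real (card S) * real (card A) * 2 ^ card S * exp (- (2 * real m * x\<^sup>2))"
proof -
  let ?I = "(S \<times> A) \<times> Pow S"
  let ?E = "\<lambda>(y, B). {h. known (mem h) (fst y) (snd y) \<and>
    x < sum (phat (mem h) (fst y) (snd y)) B - measure_pmf.prob (trans M (fst y) (snd y)) B}"
  have "measure_pmf.prob (H n) {h. \<not> accurate x (mem h)} \<le> measure_pmf.prob (H n) (\<Union>i\<in>?I. ?E i)"
    by (rule measure_pmf.finite_measure_mono) (fastforce simp: accurate_def not_le, simp)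
  also have "\<dots> \<le> (\<Sum>i\<in>?I. measure_pmf.prob (H n) (?E i))"
    using finS finA by (intro measure_pmf.finite_measure_subadditive_finite) auto
  also have "\<dots> \<le> (\<Sum>i\<in>?I. exp (- (2 * real m * x\<^sup>2)))"
  proof (rule sum_mono)
    fix i assume "i \<in> ?I"
    then obtain s a B where i: "i = ((s, a), B)" "finite B" using finS by (auto intro: finite_subset)
    show "measure_pmf.prob (H n) (?E i) \<le> exp (- (2 * real m * x\<^sup>2))"
      using prob_deviation_le[OF x i(2), of n s a] by (simp add: i(1))
  qed
  also have "\<dots> = real (card S) * real (card A) * 2 ^ card S * exp (- (2 * real m * x\<^sup>2))"
    using finS by (simp add: card_cartesian_product card_Pow)
  finally show ?thesis .
qed

text \<open>While the run stays among known pairs, the conditional mean of the next escape value is the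
  current one divided by the discount factor; this upward drift outweighs the
  second-order term of the exponential.\<close>
lemma potential_supermartingale:
  assumes h: "h \<in> set_pmf (H n)"
  shows "measure_pmf.expectation (list_step M learner s0 h) (\<lambda>x. potential (h @ [x])) \<le> potential h"
proof -
  define s a c where "s = fst (last h)" and "a = snd (last h)" and "c = mem h"
  note ne = hist_last(1)[OF M learner s0 h]
  have s: "s \<in> S" and aA: "a \<in> A" using hist_last(2)[OF M learner s0 h] by (auto simp: s_def a_def mem_Times_iff)
  have a: "a = act c s" using greedy_last[OF h] by (simp add: s_def a_def c_def)
  have mem: "mem (h @ [x]) = update s a (fst x) c" for x
    using memory_snoc[OF ne] by (simp add: s_def a_def c_def)
  let ?l = "1 - \<gamma>"
  have l: "0 < ?l" "?l \<le> 1" using \<gamma> by auto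
  show ?thesis
  proof (cases "known c s a")
    case True
    let ?e = "escape c s" and ?E = "measure_pmf.expectation (trans M s a)"
    let ?K = "exp (?l * (?l / 2 * (escape_sum h + ?e) - real (nu c)))"
    have eq: "potential (h @ [x]) = ?K * exp (- (?l * escape c (fst x)))" for x
      unfolding potential_def mem exp_add[symmetric] escape_sum_snoc[OF ne]
      using True by (intro arg_cong[of _ _ exp])
        (simp add: update_known escape_term_def s_def[symmetric] a_def[symmetric] c_def[symmetric] algebra_simps)
    have int: "integrable (measure_pmf (trans M s a)) f" for f :: "'s \<Rightarrow> real"
      by (rule integrable_measure_pmf_finite[OF fin_trans[OF s aA]])
    let ?mu = "?E (escape c)"
    have mu0: "0 \<le> ?mu"
      using escape_range(1) trans_closed[OF s aA] by (intro integral_nonneg_AE) (auto simp: AE_measure_pmf_iff)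
    have "?E (\<lambda>s'. exp (- (?l * escape c s'))) \<le> ?E (\<lambda>s'. 1 - ?l * (1 - ?l / 2) * escape c s')"
    proof (rule expectation_mono_pmf[OF fin_trans[OF s aA]])
      fix s' assume "s' \<in> set_pmf (trans M s a)"
      then have s': "s' \<in> S" using trans_closed[OF s aA] by auto
      note er = escape_range[OF s', of c]
      have "exp (- (?l * escape c s')) \<le> 1 - ?l * escape c s' + (?l * escape c s')\<^sup>2 / 2"
        using er l by (intro exp_minus_le_quadratic) auto
      \<comment> \<open>An escape value lies in \<open>[0, 1]\<close>, so its square is at most
        itself and the quadratic term becomes linear.\<close>
      also have "(?l * escape c s')\<^sup>2 \<le> ?l\<^sup>2 * escape c s'"
        unfolding power_mult_distrib using er
        by (intro mult_left_mono) (auto simp: power2_eq_square mult_left_le)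
      finally show "exp (- (?l * escape c s')) \<le> 1 - ?l * (1 - ?l / 2) * escape c s'"
        by (simp add: power2_eq_square algebra_simps)
    qed
    also have "\<dots> = 1 + - (?l * (1 - ?l / 2) * ?mu)" using int by simp
    also have "\<dots> \<le> exp (- (?l * (1 - ?l / 2) * ?mu))" by (rule exp_ge_add_one_self)
    also have "\<dots> \<le> exp (- (?l * ((1 + ?l / 2) * ?e)))"
    proof -
      have "0 \<le> ?l\<^sup>2 * ?mu" using mu0 by simp
      then have "(1 + ?l / 2) * (\<gamma> * ?mu) \<le> (1 - ?l / 2) * ?mu"
        by (simp add: power2_eq_square field_simps)
      then have "(1 + ?l / 2) * ?e \<le> (1 - ?l / 2) * ?mu"
        using escape_known[OF s, of c] True a by simp
      from mult_left_mono[OF this, of ?l] show ?thesis using l by (simp add: mult.assoc)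
    qed
    finally have "?E (\<lambda>s'. ?K * exp (- (?l * escape c s'))) \<le> ?K * exp (- (?l * ((1 + ?l / 2) * ?e)))"
      by simp
    also have "\<dots> = potential h"
      unfolding potential_def exp_add[symmetric] s_def[symmetric] c_def[symmetric]
      by (intro arg_cong[of _ _ exp]) (simp add: field_simps)
    finally show ?thesis
      unfolding eq expectation_step_fst[OF h, of "\<lambda>s'. ?K * exp (- (?l * escape c s'))"]
      by (simp only: s_def a_def)
  next
    case False
    then have e: "escape c s = 1" using escape_unknown[OF s] a by simp
    \<comment> \<open>Here the inequality is pointwise. Learning may replace the whole table, but
      the old escape value was 1, the new one is nonnegative, and \<open>nu\<close> grows by
      1.\<close>
    have "potential (h @ [x]) \<le> potential h" if x: "x \<in> set_pmf (list_step M learner s0 h)" for x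
    proof -
      have hx: "h @ [x] \<in> set_pmf (H (Suc n))"
        unfolding hist.simps(2)[of M learner s0 "Suc n"] using h x by (auto simp del: hist.simps)
      have "fst x \<in> S" using hist_last(2)[OF M learner s0 hx] by (auto simp: mem_Times_iff)
      from escape_range(1)[OF this] have "0 \<le> escape (mem (h @ [x])) (fst x)" .
      moreover have "nu (mem (h @ [x])) = nu c + 1" unfolding mem by (rule nu_update[OF s aA False])
      moreover have "escape_sum (h @ [x]) = escape_sum h"
        using False by (simp add: escape_sum_snoc[OF ne] escape_term_def s_def a_def c_def)
      ultimately show ?thesis
        unfolding potential_def using l e s_def c_def by (simp del: sum.cartesian_product' add: mult_left_mono)
    qed
    moreover have "finite (set_pmf (list_step M learner s0 h))"
      using hist_in_lists[OF mdp learner s0 h] by (rule finite_list_step[OF M learner s0])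
    ultimately have "measure_pmf.expectation (list_step M learner s0 h) (\<lambda>x. potential (h @ [x]))
      \<le> measure_pmf.expectation (list_step M learner s0 h) (\<lambda>x. potential h)"
      by (intro expectation_mono_pmf)
    then show ?thesis by simp
  qed
qed

text \<open>Markov's inequality for \<open>potential\<close>, which is at most 1 initially. The
  first summand of the exponent bounds the two subtracted quantities: \<open>nu\<close>, and an
  escape value of at most 1.\<close>

lemma prob_escape_sum_gt_le:
  "measure_pmf.prob (H n) {h. \<theta> < escape_sum h}
    \<le> exp ((1 - \<gamma>) * (1 + real (m * (card S * card A))) - (1 - \<gamma>) * ((1 - \<gamma>) / 2 * \<theta>))"
    (is "_ \<le> exp (?l * ?N - ?l * ?T)")
proof -
  have l: "0 < ?l" using \<gamma> by auto
  have "exp (?l * ?T - ?l * ?N) * measure_pmf.prob (H n) {h. \<theta> < escape_sum h}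
      \<le> measure_pmf.expectation (H n) potential"
  proof (rule pmf_prob_le_expectation[OF finH])
    fix h assume h: "h \<in> set_pmf (H n)" "h \<in> {h. \<theta> < escape_sum h}"
    have "fst (last h) \<in> S" using hist_last(2)[OF M learner s0 h(1)] by (auto simp: mem_Times_iff)
    from escape_range(2)[OF this] have e: "escape (mem h) (fst (last h)) \<le> 1" .
    have nu: "real (nu (mem h)) \<le> real (m * (card S * card A))"
      using nu_le[OF consistent_mem[OF h(1)]] by (simp only: of_nat_le_iff)
    have "?T \<le> ?l / 2 * escape_sum h" using h(2) l by (intro mult_left_mono) auto
    then have "?T - ?N \<le> ?l / 2 * escape_sum h - real (nu (mem h)) - escape (mem h) (fst (last h))"
      using e nu by linarith
    from mult_left_mono[OF this, of ?l] l
    show "exp (?l * ?T - ?l * ?N) \<le> potential h"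
      unfolding potential_def right_diff_distrib[symmetric] by simp
  qed (simp add: potential_def)
  also have "\<dots> \<le> measure_pmf.expectation (H 0) potential"
    by (rule expectation_hist_le[OF M learner s0 potential_supermartingale])
  also have "\<dots> \<le> measure_pmf.expectation (H 0) (\<lambda>_. 1)"
  proof (rule expectation_mono_pmf[OF finH])
    fix h assume h: "h \<in> set_pmf (H 0)"
    have "fst (last h) \<in> S" using hist_last(2)[OF M learner s0 h] by (auto simp: mem_Times_iff)
    from escape_range(1)[OF this, of "mem h"]
    have "?l / 2 * escape_sum h - real (nu (mem h)) - escape (mem h) (fst (last h)) \<le> 0"
      using h by (auto simp: escape_sum_def memory_singleton rmax_init_def)
    then show "potential h \<le> 1" using l by (simp add: potential_def mult_nonneg_nonpos)
  qed
  finally have "exp (- (?l * ?N - ?l * ?T)) * measure_pmf.prob (H n) {h. \<theta> < escape_sum h} \<le> 1" by simp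
  then show ?thesis unfolding exp_minus by (simp add: field_simps)
qed

section \<open>Counting the bad timesteps\<close>

lemma escape_ge_if_bad:
  assumes h: "h \<in> set_pmf (H n)" and acc: "accurate x (mem h)" and x: "0 \<le> x"
    and \<epsilon>: "2 * (x * Vm\<^sup>2) + \<epsilon>1 \<le> \<epsilon> / 2" and bad: "bad \<epsilon> h"
  shows "\<epsilon> * (1 - \<gamma>) / 2 \<le> escape (mem h) (fst (last h))"
proof -
  have s: "fst (last h) \<in> S" using hist_last(2)[OF M learner s0 h] by (auto simp: mem_Times_iff)
  \<comment> \<open>Model and planning errors use up at most half of \<epsilon>, so the escape term
    must account for more than the other half.\<close>
  have "\<epsilon> / 2 < Vm * escape (mem h) (fst (last h))"
    using regret_le_escape[OF consistent_mem[OF h] acc x s] bad \<epsilon> unfolding bad_def by linarith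
  then show ?thesis using \<gamma> by (simp add: field_simps)
qed

text \<open>A bad timestep at a known pair adds at least
  \<open>\<epsilon> * (1 - \<gamma>) / 2\<close> to \<open>escape_sum\<close>; one at an unknown
  pair adds 1 to \<open>nu\<close>. Accuracy of the final memory is inherited by the prefixes, so
  the induction goes through.\<close>

lemma num_bad_le:
  assumes h: "h \<in> set_pmf (H n)" and acc: "accurate x (mem h)" and x: "0 \<le> x" and \<epsilon>: "0 < \<epsilon>"
    and small: "2 * (x * Vm\<^sup>2) + \<epsilon>1 \<le> \<epsilon> / 2"
  shows "real (num_bad \<epsilon> h) * (\<epsilon> * (1 - \<gamma>) / 2) \<le> escape_sum h + real (nu (mem h)) * (\<epsilon> * (1 - \<gamma>) / 2)"
  using h acc
proof (induction n arbitrary: h)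
  case 0
  then have "length h = 1" using length_hist by fastforce
  then show ?case using \<epsilon> \<gamma> by (simp add: num_bad_def escape_sum_def sum_nonneg)
next
  case (Suc n)
  define p where "p = \<epsilon> * (1 - \<gamma>) / 2"
  from Suc.prems(1) obtain h' y where h: "h = h' @ [y]" and h': "h' \<in> set_pmf (H n)" and ne: "h' \<noteq> []"
    and sa: "fst (last h') \<in> S" "snd (last h') \<in> A"
    and mem: "mem h = update (fst (last h')) (snd (last h')) (fst y) (mem h')"
    by (rule hist_SucE)
  define s a c where "s = fst (last h')" and "a = snd (last h')" and "c = mem h'"
  have acc: "accurate x (mem h')" using Suc.prems(2) unfolding mem by (rule accurate_update)
  have p: "0 \<le> p" using \<epsilon> \<gamma> by (simp add: p_def)
  have nb: "num_bad \<epsilon> h = num_bad \<epsilon> h' + of_bool (bad \<epsilon> h')"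
    unfolding h num_bad_def by (rule sum_prefixes_snoc[OF ne])
  have es: "escape_sum h = escape_sum h' + escape_term h'"
    unfolding h by (rule escape_sum_snoc[OF ne])
  note IH = Suc.IH[OF h' acc, folded p_def]
  have "real (num_bad \<epsilon> h) * p \<le> escape_sum h + real (nu (mem h)) * p"
  proof (cases "known c s a")
    case True
    have "nu (mem h) = nu (mem h')" using True unfolding mem by (simp add: update_known s_def a_def c_def)
    moreover have "of_bool (bad \<epsilon> h') * p \<le> escape_term h'"
      using True escape_ge_if_bad[OF h' acc x small] escape_range(1)[OF sa(1), of c]
      by (auto simp: escape_term_def s_def a_def c_def p_def)
    ultimately show ?thesis using IH unfolding nb es by (simp add: distrib_right)
  next
    case False
    then have "nu (mem h) = nu (mem h') + 1"
      unfolding mem s_def a_def c_def by (intro nu_update sa)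
    then have "real (nu (mem h)) = real (nu (mem h')) + 1" by (simp only: of_nat_add of_nat_1)
    moreover have "escape_term h' = 0" using False by (simp add: escape_term_def s_def a_def c_def)
    moreover have "of_bool (bad \<epsilon> h') * p \<le> p" using p by simp
    ultimately show ?thesis using IH unfolding nb es of_nat_add of_nat_of_bool distrib_right by (simp only: distrib_right)
  qed
  then show ?case by (simp only: p_def)
qed

lemma prob_num_bad_ge:
  assumes x: "0 \<le> x" and \<epsilon>: "0 < \<epsilon>" and small: "2 * (x * Vm\<^sup>2) + \<epsilon>1 \<le> \<epsilon> / 2"
    and \<delta>: "real (card S) * real (card A) * 2 ^ card S * exp (- (2 * real m * x\<^sup>2))
      + exp ((1 - \<gamma>) * (1 + real (m * (card S * card A))) - (1 - \<gamma>) * ((1 - \<gamma>) / 2 * \<theta>)) \<le> \<delta>"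
    and b: "\<theta> / (\<epsilon> * (1 - \<gamma>) / 2) + real (m * (card S * card A)) \<le> b"
  shows "1 - \<delta> \<le> measure_pmf.prob (H n) {h. real (num_bad \<epsilon> h) \<le> b}"
proof -
  let ?p = "H n" and ?q = "\<epsilon> * (1 - \<gamma>) / 2"
  let ?X = "{h. \<not> accurate x (mem h)}" and ?Y = "{h. \<theta> < escape_sum h}"
  have q: "0 < ?q" using \<epsilon> \<gamma> by simp
  have sub: "real (num_bad \<epsilon> h) \<le> b" if h: "h \<in> set_pmf ?p" and n: "h \<notin> ?X" "h \<notin> ?Y" for h
  proof -
    have "real (num_bad \<epsilon> h) * ?q \<le> escape_sum h + real (nu (mem h)) * ?q"
      using n by (intro num_bad_le[OF h _ x \<epsilon> small]) auto
    also have "\<dots> \<le> \<theta> + real (m * (card S * card A)) * ?q"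
      using n nu_le[OF consistent_mem[OF h]] q by (intro add_mono mult_right_mono) (auto simp only: of_nat_le_iff mem_Collect_eq not_less)
    finally have "real (num_bad \<epsilon> h) \<le> (\<theta> + real (m * (card S * card A)) * ?q) / ?q"
      using q by (simp only: le_divide_eq if_True)
    also have "\<dots> = \<theta> / ?q + real (m * (card S * card A))"
      using q by (simp only: add_divide_distrib nonzero_mult_div_cancel_right[OF less_imp_neq[OF q, symmetric]])
    finally show ?thesis using b by linarith
  qed
  have "measure_pmf.prob ?p {h. \<not> real (num_bad \<epsilon> h) \<le> b} \<le> measure_pmf.prob ?p (?X \<union> ?Y)"
    using sub by (intro measure_pmf.finite_measure_mono_AE) (auto simp: AE_measure_pmf_iff simp del: hist.simps)
  also have "\<dots> \<le> measure_pmf.prob ?p ?X + measure_pmf.prob ?p ?Y"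
    by (rule measure_Un_le) auto
  also have "\<dots> \<le> \<delta>"
    using prob_not_accurate_le[OF x, of n] prob_escape_sum_gt_le[of n \<theta>] \<delta> by linarith
  finally have "measure_pmf.prob ?p {h. \<not> real (num_bad \<epsilon> h) \<le> b} \<le> \<delta>" .
  moreover have "measure_pmf.prob ?p {h. \<not> real (num_bad \<epsilon> h) \<le> b} = 1 - measure_pmf.prob ?p {h. real (num_bad \<epsilon> h) \<le> b}"
    using measure_pmf.prob_compl[of "{h. real (num_bad \<epsilon> h) \<le> b}" ?p]
    by (simp add: Compl_eq_Diff_UNIV[symmetric] Collect_neg_eq del: hist.simps)
  ultimately show ?thesis by linarith
qed

text \<open>The bound is uniform in the horizon and the events \<open>G n\<close> decrease, so
  continuity from above carries it to the intersection without loss.\<close>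

lemma prob_finitely_many_bad:
  assumes prob: "\<And>n. 1 - \<delta> \<le> measure_pmf.prob (H n) {h. real (num_bad \<epsilon> h) \<le> b}"
  shows "1 - \<delta> \<le> measure (traj M learner s0) {\<omega> \<in> space (traj M learner s0).
     let bad = {t. \<not> opt_val M (fst (\<omega> t)) - val M (rmax_policy_at M m \<epsilon>1 g \<omega> t) (fst (\<omega> t)) \<le> \<epsilon>}
     in finite bad \<and> real (card bad) \<le> b}" (is "_ \<le> measure ?T ?G")
proof -
  interpret prob_space ?T by (rule prob_space_traj[OF M learner s0])
  define G where "G n = (\<lambda>\<omega>. map \<omega> [0..<Suc n]) -` {h. real (num_bad \<epsilon> h) \<le> b} \<inter> space ?T" for n
  have G: "G n \<in> sets ?T" for n
    unfolding G_def by (rule measurable_sets[OF measurable_prefix_traj[OF M learner s0]]) simp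
  have "measure ?T (G n) = measure (distr ?T (count_space UNIV) (\<lambda>\<omega>. map \<omega> [0..<Suc n])) {h. real (num_bad \<epsilon> h) \<le> b}" for n
    unfolding G_def by (rule measure_distr[OF measurable_prefix_traj[OF M learner s0], symmetric]) simp
  then have PG: "1 - \<delta> \<le> measure ?T (G n)" for n
    using prob[of n] by (simp only: distr_traj_prefix[OF M learner s0])
  have "?G = (\<Inter>n. G n)"
    unfolding G_def vimage_def mem_Collect_eq num_bad_prefix Let_def finite_card_le_iff by auto
  moreover have "(\<lambda>n. measure ?T (G n)) \<longlonglongrightarrow> measure ?T (\<Inter>n. G n)"
  proof (rule finite_Lim_measure_decseq)
    show "range G \<subseteq> sets ?T" using G by auto
    show "decseq G"
    proof (rule decseq_SucI)
      have "card (B \<inter> {..<n}) \<le> card (B \<inter> {..<Suc n})" for B n by (rule card_mono) auto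
      then have "real (card (B \<inter> {..<Suc n})) \<le> b \<Longrightarrow> real (card (B \<inter> {..<n})) \<le> b" for B n
        by (meson of_nat_le_iff order_trans)
      then show "G (Suc n) \<subseteq> G n" for n
        unfolding G_def vimage_def mem_Collect_eq num_bad_prefix by blast
    qed
  qed
  ultimately show ?thesis
    using PG by (intro LIMSEQ_le_const[of "\<lambda>n. measure ?T (G n)"]) auto
qed

end

end

text \<open>The factor \<open>32 / (\<epsilon>\<^sup>2 (1 - \<gamma>)\<^sup>4)\<close> is \<open>1 / (2 x\<^sup>2)\<close> for the accuracy \<open>x = \<epsilon> (1 - \<gamma>)\<^sup>2 / 8\<close> of the
  transition frequencies.\<close>

definition sample_size :: "real \<Rightarrow> real \<Rightarrow> real \<Rightarrow> nat \<Rightarrow> nat \<Rightarrow> nat" where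
  "sample_size \<gamma> \<epsilon> \<delta> N K =
     nat \<lceil>32 * (real N * ln 2 + ln (2 * real N * real K / \<delta>)) / (\<epsilon>\<^sup>2 * (1 - \<gamma>) ^ 4)\<rceil>"

section \<open>Choice of the parameters and orders of growth\<close>

lemma inverse_gap_bounds:
  fixes \<epsilon> \<gamma> :: real
  assumes "0 \<le> \<gamma>" "\<gamma> < 1" "0 < \<epsilon>" "\<epsilon> < 1 / (1 - \<gamma>)"
  shows "\<epsilon>\<^sup>2 * (1 - \<gamma>) ^ 4 \<le> 1 - \<gamma>" "\<epsilon> * (1 - \<gamma>)\<^sup>2 \<le> 1" "\<epsilon>\<^sup>2 * (1 - \<gamma>) ^ 4 \<le> 1"
proof -
  \<comment> \<open>All three bounds come from \<open>\<epsilon> * (1 - \<gamma>) \<le> 1\<close>.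
    They serve to absorb lower-order terms: rounding, \<open>ln (2 / \<delta>)\<close> and the
    visits to unknown pairs themselves.\<close>
  have e: "0 \<le> \<epsilon> * (1 - \<gamma>)" "\<epsilon> * (1 - \<gamma>) \<le> 1" using assms by (auto simp: field_simps)
  have "(\<epsilon> * (1 - \<gamma>)) * (1 - \<gamma>) \<le> 1 * 1" using e assms by (intro mult_mono) auto
  then show "\<epsilon> * (1 - \<gamma>)\<^sup>2 \<le> 1" by (simp add: power2_eq_square mult.assoc)
  have "(\<epsilon> * (1 - \<gamma>))\<^sup>2 * (1 - \<gamma>) \<le> 1 * 1" using e assms by (intro mult_mono power_le_one) auto
  then have "(\<epsilon> * (1 - \<gamma>))\<^sup>2 * (1 - \<gamma>) * (1 - \<gamma>) \<le> 1 * (1 - \<gamma>)" using assms by (intro mult_right_mono) auto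
  then show "\<epsilon>\<^sup>2 * (1 - \<gamma>) ^ 4 \<le> 1 - \<gamma>" by (simp add: power2_eq_square power4_eq_xxxx mult_ac)
  then show "\<epsilon>\<^sup>2 * (1 - \<gamma>) ^ 4 \<le> 1" using assms by linarith
qed

text \<open>A quarter of \<epsilon> goes to the two uses of accuracy, a quarter to value iteration
  and half to escaping; \<delta> is split evenly between inaccurate frequencies and an excessive
  escape sum.\<close>

theorem rmax_sample_complexity:
  fixes M :: "('s, 'a) mdp"
  assumes M: "tabular M" and g: "greedy_rule M g" and s0: "s0 \<in> states M"
    and r: "\<And>s a. s \<in> states M \<Longrightarrow> a \<in> actions M \<Longrightarrow> 0 \<le> rew M s a \<and> rew M s a \<le> 1"
    and \<epsilon>: "0 < \<epsilon>" "\<epsilon> < 1 / (1 - disc M)" and \<delta>: "0 < \<delta>" "\<delta> < 1"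
  defines "m \<equiv> sample_size (disc M) \<epsilon> \<delta> (card (states M)) (card (actions M))"
  assumes b: "13 * (real m * real (card (states M)) * real (card (actions M))) / (\<epsilon> * (1 - disc M)\<^sup>2) \<le> b"
  shows "1 - \<delta> \<le> measure (traj M (rmax M m (\<epsilon> / 4) g) s0) {\<omega> \<in> space (traj M (rmax M m (\<epsilon> / 4) g) s0).
     let bad = {t. \<not> opt_val M (fst (\<omega> t)) - val M (rmax_policy_at M m (\<epsilon> / 4) g \<omega> t) (fst (\<omega> t)) \<le> \<epsilon>}
     in finite bad \<and> real (card bad) \<le> b}"
proof -
  define N K l where "N = card (states M)" and "K = card (actions M)" and "l = 1 - disc M"
  \<comment> \<open>Chosen so that \<open>N * K * 2 ^ N * exp (- B)\<close> is
    \<open>\<delta> / 2\<close>.\<close>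
  define B where "B = real N * ln 2 + ln (2 * real N * real K / \<delta>)"
  have \<gamma>: "0 \<le> disc M" "disc M < 1" and l: "0 < l" "l \<le> 1"
    and fin: "finite (states M)" "finite (actions M)" "states M \<noteq> {}" "actions M \<noteq> {}"
    using M by (auto simp: tabular_def mdp_def l_def)
  have NK: "1 \<le> real N" "1 \<le> real K" "1 \<le> real N * real K"
  proof -
    show "1 \<le> real N" "1 \<le> real K"
      using fin by (auto simp: N_def K_def Suc_le_eq card_gt_0_iff)
    then have "1 * 1 \<le> real N * real K" by (intro mult_mono) auto
    then show "1 \<le> real N * real K" by simp
  qed
  note gap = inverse_gap_bounds[OF \<gamma> \<epsilon>, folded l_def]
  have den: "0 < \<epsilon>\<^sup>2 * l ^ 4" using \<epsilon> l by simp
  have ln2d: "ln (2 / \<delta>) \<le> B" "0 < ln (2 / \<delta>)"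
  proof -
    have "2 / \<delta> \<le> 2 * real N * real K / \<delta>" using NK(3) \<delta> by (simp add: divide_right_mono)
    then have "ln (2 / \<delta>) \<le> ln (2 * real N * real K / \<delta>)" using \<delta> by (intro ln_mono) auto
    then show "ln (2 / \<delta>) \<le> B" using NK unfolding B_def by (simp add: add_increasing)
    show "0 < ln (2 / \<delta>)" using \<delta> by (intro ln_gt_zero) (simp add: field_simps)
  qed
  have B0: "0 < B" using ln2d by linarith
  have mB: "32 * B / (\<epsilon>\<^sup>2 * l ^ 4) \<le> real m"
    unfolding m_def sample_size_def B_def N_def K_def l_def by linarith
  have m: "0 < m"
    using mB B0 den by (metis divide_pos_pos mult_pos_pos not_gr_zero not_less of_nat_0 zero_less_numeral)
  interpret rmax_learner M m "\<epsilon> / 4" g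
    using M m \<epsilon> g r by unfold_locales auto
  let ?x = "\<epsilon> * l\<^sup>2 / 8"
  let ?n = "real m * real N * real K"
  \<comment> \<open>Chosen so that \<open>exp (l * (1 + ?n) - l * (l / 2 * ?\<theta>))\<close> is
    \<open>\<delta> / 2\<close>.\<close>
  let ?\<theta> = "(l * (1 + ?n) + ln (2 / \<delta>)) / (l * (l / 2))"
  have n: "real m \<le> ?n"
    using mult_left_mono[OF NK(3), of "real m"] by (simp add: mult.assoc)
  have n1: "1 \<le> ?n" using n m by linarith
  show ?thesis
  proof (rule prob_finitely_many_bad[OF s0], rule prob_num_bad_ge[OF s0, where x = ?x and \<theta> = ?\<theta>])
    show "0 \<le> ?x" "0 < \<epsilon>" using \<epsilon> by auto
    have "?x * Vm\<^sup>2 = \<epsilon> / 8" using l unfolding l_def[symmetric] by (simp add: power_divide)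
    then show "2 * (?x * Vm\<^sup>2) + \<epsilon> / 4 \<le> \<epsilon> / 2" by linarith
  next
    have "B \<le> 2 * real m * ?x\<^sup>2"
    proof -
      have "32 * B \<le> real m * (\<epsilon>\<^sup>2 * l ^ 4)" using mB den by (simp add: divide_le_eq)
      also have "\<dots> = 32 * (2 * real m * ?x\<^sup>2)" by (simp add: power_divide power_mult_distrib flip: power_mult)
      finally show ?thesis by simp
    qed
    then have "real N * real K * 2 ^ N * exp (- (2 * real m * ?x\<^sup>2)) \<le> real N * real K * 2 ^ N * exp (- B)"
      by (intro mult_left_mono) auto
    also have "exp (- B) = (1 / 2 ^ N) * (\<delta> / (2 * real N * real K))"
    proof -
      have "exp (- B) = exp (- (real N * ln 2)) * exp (- ln (2 * real N * real K / \<delta>))"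
        by (simp add: B_def mult_exp_exp)
      moreover have "exp (real N * ln 2) = 2 ^ N" by (simp add: exp_of_nat_mult)
      moreover have "exp (ln (2 * real N * real K / \<delta>)) = 2 * real N * real K / \<delta>"
        using NK \<delta> by (intro exp_ln) auto
      ultimately show ?thesis by (simp add: exp_minus field_simps)
    qed
    also have "real N * real K * 2 ^ N * \<dots> = \<delta> / 2" using NK by simp
    finally have 1: "real N * real K * 2 ^ N * exp (- (2 * real m * ?x\<^sup>2)) \<le> \<delta> / 2" .
    have "l * (l / 2 * ?\<theta>) = l * (1 + ?n) + ln (2 / \<delta>)" using l by simp
    then have "exp (l * (1 + ?n) - l * (l / 2 * ?\<theta>)) = exp (- ln (2 / \<delta>))" by simp
    also have "\<dots> = \<delta> / 2" using \<delta> by (simp add: exp_minus)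
    finally have 2: "exp (l * (1 + ?n) - l * (l / 2 * ?\<theta>)) = \<delta> / 2" .
    show "real (card S) * real (card A) * 2 ^ card S * exp (- (2 * real m * ?x\<^sup>2))
      + exp ((1 - \<gamma>) * (1 + real (m * (card S * card A))) - (1 - \<gamma>) * ((1 - \<gamma>) / 2 * ?\<theta>)) \<le> \<delta>"
      using 1 2 by (simp add: N_def[symmetric] K_def[symmetric] l_def[symmetric] mult.assoc)
  next
    have "ln (2 / \<delta>) / l \<le> ?n"
    proof -
      have "ln (2 / \<delta>) / l \<le> 32 * B / (\<epsilon>\<^sup>2 * l ^ 4)"
        using ln2d B0 l gap(1) den by (intro frac_le) auto
      then show ?thesis using mB n by linarith
    qed
    \<comment> \<open>Three terms of at most \<open>?n\<close> are doubled on dividing by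
      \<open>l / 2\<close>; the later division by \<open>\<epsilon> * l / 2\<close> doubles again to
      12, and the visits to unknown pairs make the thirteenth.\<close>
    then have "?\<theta> \<le> 6 * ?n / l"
    proof -
      assume le: "ln (2 / \<delta>) / l \<le> ?n"
      have "?\<theta> = 2 * (1 + ?n + ln (2 / \<delta>) / l) / l" using l by (simp add: field_simps)
      also have "\<dots> \<le> 2 * (3 * ?n) / l"
      proof (rule divide_right_mono)
        have "2 * (1 + u + v) \<le> 2 * (3 * u)" if "v \<le> u" "1 \<le> u" for u v :: real using that by simp
        from this[OF le n1] show "2 * (1 + ?n + ln (2 / \<delta>) / l) \<le> 2 * (3 * ?n)" .
      qed (use l in simp)
      finally show ?thesis by simp
    qed
    then have "?\<theta> / (\<epsilon> * l / 2) \<le> 6 * ?n / l / (\<epsilon> * l / 2)" using \<epsilon> l by (intro divide_right_mono) auto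
    also have "\<dots> = 12 * ?n / (\<epsilon> * l\<^sup>2)" using \<epsilon> l by (simp add: field_simps power2_eq_square)
    finally have 1: "?\<theta> / (\<epsilon> * l / 2) \<le> 12 * ?n / (\<epsilon> * l\<^sup>2)" .
    have 2: "?n \<le> ?n / (\<epsilon> * l\<^sup>2)" using gap(2) \<epsilon> l n1 by (simp add: le_divide_eq mult_left_le)
    have "?\<theta> / (\<epsilon> * l / 2) + ?n \<le> 12 * ?n / (\<epsilon> * l\<^sup>2) + ?n / (\<epsilon> * l\<^sup>2)"
      by (rule add_mono[OF 1 2])
    also have "\<dots> = 13 * ?n / (\<epsilon> * l\<^sup>2)" by (simp add: add_divide_distrib[symmetric])
    also have "\<dots> \<le> b" using b by (simp add: N_def K_def l_def)
    finally have "?\<theta> / (\<epsilon> * l / 2) + ?n \<le> b" .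
    then show "?\<theta> / (\<epsilon> * (1 - \<gamma>) / 2) + real (m * (card S * card A)) \<le> b"
      by (simp add: N_def K_def l_def mult.assoc)
  qed
qed

text \<open>\<open>N\<close> itself, and not just its logarithm, stands before \<open>L\<close>, so
  the crude estimates \<open>ln K \<le> d * ln q \<le> N * ln q\<close> and
  \<open>ln N \<le> N - 1\<close> are affordable.\<close>

lemma sample_size_le:
  assumes \<gamma>: "0 \<le> \<gamma>" "\<gamma> < 1" and \<epsilon>: "0 < \<epsilon>" "\<epsilon> < 1 / (1 - \<gamma>)" and \<delta>: "0 < \<delta>" "\<delta> < 1"
    and N: "1 \<le> N" "real d \<le> real N" and K: "1 \<le> K" "real K \<le> q ^ d" and q: "1 \<le> q"
    and L: "1 + ln q + ln (1 / \<delta>) \<le> L"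
  shows "real (sample_size \<gamma> \<epsilon> \<delta> N K) \<le> 97 * (real N / (\<epsilon>\<^sup>2 * (1 - \<gamma>) ^ 4)) * L"
proof -
  let ?den = "\<epsilon>\<^sup>2 * (1 - \<gamma>) ^ 4"
  let ?B = "real N * ln 2 + ln (2 * real N * real K / \<delta>)"
  have den: "0 < ?den" "?den \<le> 1" using inverse_gap_bounds(3)[OF \<gamma> \<epsilon>] \<gamma> \<epsilon> by auto
  have lnq: "0 \<le> ln q" using q by simp
  have ln\<delta>: "0 \<le> ln (1 / \<delta>)" using \<delta> by (intro ln_ge_zero) auto
  have ln2: "0 \<le> ln (2::real)" "ln 2 \<le> (1::real)" using ln_le_minus_one[of "2::real"] by auto
  have L1: "1 \<le> L" using L lnq ln\<delta> by linarith
  have NL: "1 \<le> real N * L" using mult_mono[of 1 "real N" 1 L] N L1 by simp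
  have "ln (2 * real N * real K / \<delta>) = ln 2 + ln (real N) + ln (real K) + ln (1 / \<delta>)"
    using N K \<delta> by (simp add: ln_mult ln_div)
  moreover have "real N * ln 2 \<le> real N * 1" using ln2 by (intro mult_left_mono) auto
  moreover have "ln (real N) \<le> real N - 1" using N by (intro ln_le_minus_one) auto
  moreover have "ln (real K) \<le> real N * ln q"
  proof -
    have "ln (real K) \<le> ln (q ^ d)" using K by (intro ln_mono) auto
    also have "\<dots> = real d * ln q" using q by (simp add: ln_realpow)
    also have "\<dots> \<le> real N * ln q" using N lnq by (intro mult_right_mono) auto
    finally show ?thesis .
  qed
  moreover have "ln (1 / \<delta>) \<le> real N * ln (1 / \<delta>)"
    using mult_right_mono[of 1 "real N" "ln (1 / \<delta>)"] N ln\<delta> by simp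
  ultimately have "?B \<le> 2 * real N + real N * ln q + real N * ln (1 / \<delta>)"
    using ln2 by linarith
  also have "\<dots> = real N * (1 + (1 + ln q + ln (1 / \<delta>)))" by (simp add: algebra_simps)
  also have "\<dots> \<le> real N * (2 * L)" using L L1 by (intro mult_left_mono) auto
  finally have B: "?B \<le> 2 * (real N * L)" by simp
  have "0 \<le> ?B"
  proof -
    have "1 * 1 \<le> real N * real K" using N K by (intro mult_mono) auto
    then have "1 \<le> 2 * real N * real K / \<delta>" using \<delta> by (simp add: le_divide_eq)
    then show ?thesis using ln2 by simp
  qed
  then have "0 \<le> 32 * ?B / ?den" using den by simp
  then have "real (sample_size \<gamma> \<epsilon> \<delta> N K) \<le> 1 + 32 * ?B / ?den"
    unfolding sample_size_def by linarith
  \<comment> \<open>Rounding costs one copy of \<open>N * L / ?den\<close> and the rest 64 copies;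
    the constant 97 leaves slack.\<close>
  also have "\<dots> \<le> real N * L / ?den + 32 * (2 * (real N * L)) / ?den"
  proof (rule add_mono)
    show "1 \<le> real N * L / ?den" using den NL by (simp add: le_divide_eq)
    show "32 * ?B / ?den \<le> 32 * (2 * (real N * L)) / ?den"
      using B den by (intro divide_right_mono mult_left_mono) auto
  qed
  also have "\<dots> \<le> 97 * (real N / ?den) * L"
    using NL den by (simp add: field_simps)
  finally show ?thesis .
qed

text \<open>The bad timesteps number about
  \<open>m * N * K / (\<epsilon> * (1 - \<gamma>) ^ 2)\<close>: visits to unknown pairs, divided by
  the drift \<open>1 - \<gamma>\<close> and by the escape threshold of order
  \<open>\<epsilon> * (1 - \<gamma>)\<close>. Inserting \<open>m\<close> squares \<open>N\<close>
  and gives the exponents 3 and 6.\<close>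

theorem theorem4p13:
  "\<exists>(C :: real) (k :: nat). 0 < C \<and>
    (\<forall>(\<epsilon> :: real) (\<delta> :: real) (side :: real) (hi :: nat) (hm :: nat)
       (G :: ('s, 'a) stochastic_game) (M :: (('s, 'a) meta_state, ('s, 'a) qtable) mdp)
       (D :: ('s, 'a) qtable set).
      case_II_meta_mdp G hi hm M \<longrightarrow> 0 < side \<longrightarrow> cubic_grid_net G side D \<longrightarrow>
      0 < \<epsilon> \<longrightarrow> \<epsilon> < 1 / (1 - disc M) \<longrightarrow> 0 < \<delta> \<longrightarrow> \<delta> < 1 \<longrightarrow>
      (let \<gamma> = disc M;
           n = agents G;
           h = hi * hm;
           Md = discretise M D;
           L = log_factor G side \<gamma> \<epsilon> \<delta>
       in \<exists>(m :: nat) (\<epsilon>1 :: real).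
            0 < m \<and> 0 < \<epsilon>1 \<and>
            real m \<le> C * (real (SA G) ^ (n * h) / (\<epsilon>^2 * (1 - \<gamma>)^4)) * L ^ k \<and>
            1 / \<epsilon>1 \<le> C * (1 / \<epsilon>) \<and>
            (\<forall>g s0. greedy_rule Md g \<longrightarrow> s0 \<in> states Md \<longrightarrow>
               1 - \<delta> \<le>
               measure (traj Md (rmax Md m \<epsilon>1 g) s0)
                 {\<omega> \<in> space (traj Md (rmax Md m \<epsilon>1 g) s0).
                    let bad = {t. \<not> opt_val Md (fst (\<omega> t))
                                  - val Md (rmax_policy_at Md m \<epsilon>1 g \<omega> t) (fst (\<omega> t)) \<le> \<epsilon>}
                    in finite bad \<and>
                       real (card bad)
                       \<le> C * (real (SA G) ^ (2 * n * h) * grid_base G side ^ SA G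
                               / (\<epsilon>^3 * (1 - \<gamma>)^6)) * L ^ k})))"
\<comment> \<open>The constant exceeds \<open>13 * 97 = 1261\<close>, the product of the constants
  for the count and for \<open>m\<close>. One power of the logarithm suffices because
  \<open>m\<close> enters the count linearly.\<close>
proof (rule exI[of _ 1300], rule exI[of _ 1], intro conjI allI impI)
  show "0 < (1300 :: real)" by simp
next
  fix \<epsilon> \<delta> side :: real and hi hm :: nat and G :: "('s, 'a) stochastic_game"
    and M :: "(('s, 'a) meta_state, ('s, 'a) qtable) mdp" and D :: "('s, 'a) qtable set"
  assume caseII: "case_II_meta_mdp G hi hm M" and side: "0 < side" and net: "cubic_grid_net G side D"
    and \<epsilon>: "0 < \<epsilon>" "\<epsilon> < 1 / (1 - disc M)" and \<delta>: "0 < \<delta>" "\<delta> < 1"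
  define Md L N K l where "Md = discretise M D" and "L = log_factor G side (disc M) \<epsilon> \<delta>"
    and "N = SA G ^ (agents G * (hi * hm))" and "K = card D" and "l = 1 - disc M"
  have tab: "tabular Md" unfolding Md_def by (rule tabular_discretise[OF caseII net])
  have Md: "disc Md = disc M" "states Md = states M" "actions Md = D" "rew Md = rew M"
    by (simp_all add: Md_def discretise_def)
  have \<gamma>: "0 \<le> disc M" "disc M < 1" using caseII by (auto simp: case_II_meta_mdp_def mdp_def)
  have l: "0 < l" using \<gamma> by (simp add: l_def)
  have cardS: "card (states Md) = N"
    using caseII by (simp add: Md case_II_meta_mdp_def card_meta_states N_def)
  have cardA: "card (actions Md) = K" by (simp add: Md K_def)
  have SA1: "1 \<le> SA G" and nh: "1 \<le> agents G * (hi * hm)"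
    using caseII by (auto simp: case_II_meta_mdp_def inner_game_def Suc_le_eq card_gt_0_iff)
  have N: "1 \<le> N" "real (SA G) \<le> real N"
  proof -
    show "1 \<le> N" using SA1 by (simp add: N_def)
    have "SA G ^ 1 \<le> SA G ^ (agents G * (hi * hm))" by (rule power_increasing[OF nh SA1])
    then show "real (SA G) \<le> real N" unfolding N_def by (simp only: of_nat_le_iff power_one_right)
  qed
  have K: "1 \<le> K" "real K \<le> grid_base G side ^ SA G"
    using tab net by (auto simp: tabular_def mdp_def Md K_def cubic_grid_net_def Suc_le_eq card_gt_0_iff)
  have q: "1 \<le> grid_base G side" using side by (simp add: grid_base_def)
  have r: "0 \<le> rew Md s a \<and> rew Md s a \<le> 1" if "s \<in> states Md" "a \<in> actions Md" for s a
    using that caseII net by (auto simp: Md case_II_meta_mdp_def cubic_grid_net_def)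
  have L: "1 + ln (grid_base G side) + ln (1 / \<delta>) \<le> L"
  proof -
    have "0 \<le> ln (real (SA G))" using SA1 by (intro ln_ge_zero) linarith
    moreover have "0 \<le> ln (1 / (\<epsilon> * (1 - disc M)))" using \<epsilon> \<gamma> by (intro ln_ge_zero) (simp add: field_simps)
    moreover have "0 \<le> ln (1 / (1 - disc M))" using \<gamma> by (intro ln_ge_zero) (simp add: field_simps)
    ultimately show ?thesis unfolding L_def log_factor_def by linarith
  qed
  define m where "m = sample_size (disc M) \<epsilon> \<delta> N K"
  have m_le: "real m \<le> 97 * (real N / (\<epsilon>\<^sup>2 * l ^ 4)) * L"
    unfolding m_def l_def by (rule sample_size_le[OF \<gamma> \<epsilon> \<delta> N K q L])
  have "0 \<le> ln (1 / \<delta>)" using \<delta> by (intro ln_ge_zero) auto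
  then have L0: "0 \<le> L" using L ln_ge_zero[OF q] by linarith
  have "13 * (real m * real N * real K) / (\<epsilon> * l\<^sup>2)
      \<le> 13 * (97 * (real N / (\<epsilon>\<^sup>2 * l ^ 4)) * L * real N * grid_base G side ^ SA G) / (\<epsilon> * l\<^sup>2)"
    using m_le K \<epsilon> l L0 by (intro divide_right_mono mult_left_mono mult_mono) auto
  also have "\<dots> = 1261 * (real N ^ 2 * grid_base G side ^ SA G / (\<epsilon> ^ 3 * l ^ 6)) * L"
  proof -
    have "l ^ 6 = l ^ 4 * l\<^sup>2" by (simp flip: power_add)
    then show ?thesis using \<epsilon> l by (simp add: field_simps power2_eq_square power3_eq_cube)
  qed
  also have "\<dots> \<le> 1300 * (real N ^ 2 * grid_base G side ^ SA G / (\<epsilon> ^ 3 * l ^ 6)) * L"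
    using \<epsilon> l L0 q by (intro mult_right_mono divide_nonneg_nonneg mult_nonneg_nonneg) auto
  also have "real N ^ 2 = real (SA G) ^ (2 * agents G * (hi * hm))"
    by (simp add: N_def power_mult[symmetric] mult_ac)
  finally have b: "13 * (real m * real N * real K) / (\<epsilon> * l\<^sup>2)
      \<le> 1300 * (real (SA G) ^ (2 * agents G * (hi * hm)) * grid_base G side ^ SA G / (\<epsilon> ^ 3 * l ^ 6)) * L" .
  show "let \<gamma> = disc M; n = agents G; h = hi * hm; Md = discretise M D; L = log_factor G side \<gamma> \<epsilon> \<delta>
       in \<exists>(m :: nat) (\<epsilon>1 :: real).
            0 < m \<and> 0 < \<epsilon>1 \<and>
            real m \<le> 1300 * (real (SA G) ^ (n * h) / (\<epsilon>^2 * (1 - \<gamma>)^4)) * L ^ 1 \<and>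
            1 / \<epsilon>1 \<le> 1300 * (1 / \<epsilon>) \<and>
            (\<forall>g s0. greedy_rule Md g \<longrightarrow> s0 \<in> states Md \<longrightarrow>
               1 - \<delta> \<le>
               measure (traj Md (rmax Md m \<epsilon>1 g) s0)
                 {\<omega> \<in> space (traj Md (rmax Md m \<epsilon>1 g) s0).
                    let bad = {t. \<not> opt_val Md (fst (\<omega> t))
                                  - val Md (rmax_policy_at Md m \<epsilon>1 g \<omega> t) (fst (\<omega> t)) \<le> \<epsilon>}
                    in finite bad \<and>
                       real (card bad)
                       \<le> 1300 * (real (SA G) ^ (2 * n * h) * grid_base G side ^ SA G
                               / (\<epsilon>^3 * (1 - \<gamma>)^6)) * L ^ 1})"
    unfolding Let_def[of "disc M"] Let_def[of "agents G"] Let_def[of "hi * hm"]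
      Let_def[of "discretise M D"] Let_def[of "log_factor G side (disc M) \<epsilon> \<delta>"]
      Md_def[symmetric] L_def[symmetric] l_def[symmetric] power_one_right Let_def[of Md] Let_def[of L]
  proof (rule exI[of _ m], rule exI[of _ "\<epsilon> / 4"], intro conjI allI impI)
    show "0 < m"
    proof -
      have "1 * 1 \<le> real N * real K" using N(1) K(1) by (intro mult_mono) auto
      then have "1 \<le> 2 * real N * real K / \<delta>" using \<delta> by (simp add: le_divide_eq)
      then have "0 < real N * ln 2 + ln (2 * real N * real K / \<delta>)"
        using N(1) by (intro add_pos_nonneg) auto
      then show ?thesis unfolding m_def sample_size_def using \<epsilon> \<gamma> by simp
    qed
    show "0 < \<epsilon> / 4" "1 / (\<epsilon> / 4) \<le> 1300 * (1 / \<epsilon>)" using \<epsilon> by (simp_all add: field_simps)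
    have "0 \<le> real N / (\<epsilon>\<^sup>2 * l ^ 4) * L" using \<epsilon> l L0 by simp
    then show "real m \<le> 1300 * (real (SA G) ^ (agents G * (hi * hm)) / (\<epsilon>\<^sup>2 * l ^ 4)) * L"
      using m_le unfolding N_def by simp
  next
    fix g s0 assume g: "greedy_rule Md g" and s0: "s0 \<in> states Md"
    show "1 - \<delta> \<le> measure (traj Md (rmax Md m (\<epsilon> / 4) g) s0)
                 {\<omega> \<in> space (traj Md (rmax Md m (\<epsilon> / 4) g) s0).
                    let bad = {t. \<not> opt_val Md (fst (\<omega> t))
                                  - val Md (rmax_policy_at Md m (\<epsilon> / 4) g \<omega> t) (fst (\<omega> t)) \<le> \<epsilon>}
                    in finite bad \<and>
                       real (card bad)
                       \<le> 1300 * (real (SA G) ^ (2 * agents G * (hi * hm)) * grid_base G side ^ SA G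
                               / (\<epsilon>^3 * l ^ 6)) * L}"
      using rmax_sample_complexity[OF tab g s0 r, of \<epsilon> \<delta>] \<epsilon> \<delta> b
      unfolding Md(1) cardS cardA m_def[symmetric] l_def[symmetric] by blast
  qed
qed

end
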